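(* Let $q,n\ge 1$ and let $\mathbf f_n(z)=I_qz^n+A_1z^{n-1}+\cdots+A_n$ ($A_j\in\mathbb C^{q\times q}$, $A_0:=I_q$) be a Hurwitz-type matrix polynomial with Markov parameters $(s_j)_{j\ge0}$, where $s_0,\dots,s_{n-1}$ is a Stieltjes positive sequence. Let $\widehat H_{1,j},\widehat H_{2,j}$ be the Schur complements and $\Xi_m^{(j)},\Phi_m^{(j)},\Psi_m^{(j)},\Theta_m^{(j)}$ the matrices, defined in the context, built from the Markov parameters of $\mathbf f_n$. Then the coefficients of $\mathbf f_n$ admit the following representations. If $n=2m$, $m\ge1$, then $$A_{n-k}=\begin{cases}\Phi_m^{(j)}\,\widehat H_{1,0}^{-1}\widehat H_{2,0}\cdots\widehat H_{1,m-1}^{-1}\widehat H_{2,m-1}, & k=2j,\ 0\le j\le m,\\[1ex] \Psi_m^{(j)}\,\widehat H_{1,0}^{-1}\widehat H_{2,0}\cdots\widehat H_{1,m-1}^{-1}\widehat H_{2,m-1}, & k=2j+1,\ 0\le j\le m-1.\end{cases}$$ If $n=2m+1$, $m\ge0$, then $$A_{n-k}=\begin{cases}\Xi_m^{(j)}\,\widehat H_{1,0}\widehat H_{2,0}^{-1}\widehat H_{1,1}\cdots\widehat H_{2,m-1}^{-1}\widehat H_{1,m}, & k=2j,\ 0\le j\le m,\\[1ex] \Theta_m^{(j)}\,\widehat H_{1,0}\widehat H_{2,0}^{-1}\widehat H_{1,1}\cdots\widehat H_{2,m-1}^{-1}\widehat H_{1,m}, & k=2j+1,\ 0\le j\le m,\end{cases}$$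 where for $m=0$ the product $\widehat H_{1,0}\widehat H_{2,0}^{-1}\widehat H_{1,1}\cdots\widehat H_{2,m-1}^{-1}\widehat H_{1,m}$ is understood to be $\widehat H_{1,0}$.
   Context: **Hurwitz-type matrix (HTM) polynomials.** Write $\mathbf f_n(z)=\mathbf h_n(z^2)+z\,\mathbf g_n(z^2)$, where for $n=2m$: $\mathbf h_n(z)=I_qz^m+A_2z^{m-1}+\cdots+A_{2m}$, $\mathbf g_n(z)=A_1z^{m-1}+A_3z^{m-2}+\cdots+A_{2m-1}$; and for $n=2m+1$: $\mathbf h_n(z)=A_1z^m+A_3z^{m-1}+\cdots+A_{2m+1}$, $\mathbf g_n(z)=I_qz^m+A_2z^{m-1}+\cdots+A_{2m}$. $\mathbf f_n$ is an HTM polynomial if there are Hermitian positive definite $q\times q$ matrices $\mathbf c_0,\dots,\mathbf c_{m-1},\mathbf d_0,\dots,\mathbf d_{m-1}$ if $n=2m$ (resp. $\mathbf c_0,\dots,\mathbf c_m,\mathbf d_0,\dots,\mathbf d_{m-1}$ if $n=2m+1$) such that, as an identity of rational matrix functions, $\mathbf g_n(z)\mathbf h_n(z)^{-1}=K_0(z)$ (resp. $\mathbf h_n(z)(z\mathbf g_n(z))^{-1}=K_0(z)$), where $K_{m-1}(z)=(z\mathbf c_{m-1}+\mathbf d_{m-1}^{-1})^{-1}$ and $K_i(z)=\bigl(z\mathbf c_i+(\mathbf d_i+K_{i+1}(z))^{-1}\bigr)^{-1}$ for $i=m-2,\dots,0$ (resp. $K_m(z)=z^{-1}\mathbf c_m^{-1}$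 and $K_i(z)=\bigl(z\mathbf c_i+(\mathbf d_i+K_{i+1}(z))^{-1}\bigr)^{-1}$ for $i=m-1,\dots,0$). **Markov parameters.** The Markov parameters $s_j\in\mathbb C^{q\times q}$ of $\mathbf f_n$ are defined by the Laurent expansion at infinity $\sum_{j\ge0}(-1)^js_jz^{-j-1}$ of $\mathbf g_n(z)\mathbf h_n(z)^{-1}$ if $n=2m$, resp. of $\mathbf h_n(z)(z\mathbf g_n(z))^{-1}$ if $n=2m+1$. **Block Hankel matrices.** $H_{1,j}=(s_{a+b})_{a,b=0}^{j}$, $H_{2,j}=(s_{a+b+1})_{a,b=0}^{j}$. A sequence $(s_j)_{j=0}^{\kappa}$ is Stieltjes positive if $H_{1,j}$ is Hermitian positive definite whenever $2j\le\kappa$ and $H_{2,j}$ is Hermitian positive definite whenever $2j+1\le\kappa$. Put $y_{[j,k]}=(s_j,s_{j+1},\dots,s_k)^*$ (block column), $Y_{1,j}=y_{[j,2j-1]}$, $Y_{2,j}=y_{[j+1,2j]}$. **Schur complements.** $\widehat H_{1,0}=s_0$, $\widehat H_{2,0}=s_1$, and for $j\ge1$: $\widehat H_{1,j}=s_{2j}-Y_{1,j}^*H_{1,j-1}^{-1}Y_{1,j}$, $\widehat H_{2,j}=s_{2j+1}-Y_{2,j}^*H_{2,j-1}^{-1}Y_{2,j}$. **Matrix polynomials.** Let $T_0=0_q$, $T_j=\begin{pmatrix}0_{q\times jq}&0_q\\ I_{jq}&0_{jq\times q}\end{pmatrix}$ ($j\ge1$), $R_j(z)=(I_{(j+1)q}-zT_j)^{-1}$,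 $v_0=I_q$, $v_j=\begin{pmatrix}I_q\\0_{jq\times q}\end{pmatrix}$, $u_{2,j}=-y_{[0,j]}$. Set $P_{1,0}(z)=I_q$, $Q_{2,0}(z)=s_0$, and for $j\ge1$: $P_{1,j}(z)=(-Y_{1,j}^*H_{1,j-1}^{-1},\,I_q)R_j(z)v_j$, $Q_{2,j}(z)=-(-Y_{2,j}^*H_{2,j-1}^{-1},\,I_q)R_j(z)u_{2,j}$. **Auxiliary matrices.** $\mathcal P_{1,r}^{(0)}=P_{1,r}(0)^*\widehat H_{1,r}^{-1}P_{1,r}(0)$ and $\mathcal Q_{2,r}^{(0)}=Q_{2,r}(0)^*\widehat H_{2,r}^{-1}Q_{2,r}(0)$. Empty sums are $0_q$. For $j=0$: $\Xi_m^{(0)}=\Phi_m^{(0)}=I_q$, $\Theta_m^{(0)}=\sum_{l=0}^m\mathcal P_{1,l}^{(0)}$, $\Psi_m^{(0)}=\sum_{l=0}^{m-1}\mathcal Q_{2,l}^{(0)}$ ($m\ge0$). For $j\ge1$: $\Xi_m^{(j)}=\sum_{l=0}^m\Psi_l^{(j-1)}\mathcal P_{1,l}^{(0)}$, $\Phi_m^{(j)}=\sum_{l=0}^{m-1}\Theta_l^{(j-1)}\mathcal Q_{2,l}^{(0)}$, $\Theta_m^{(j)}=\sum_{l=0}^m\Phi_l^{(j)}\mathcal P_{1,l}^{(0)}$, $\Psi_m^{(j)}=\sum_{l=0}^{m-1}\Xi_l^{(j)}\mathcal Q_{2,l}^{(0)}$. *)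

theory Defs
  imports Complex_Main "Jordan_Normal_Form.Schur_Decomposition"
begin

text \<open>
  Matrix sizes such as \<open>(j + 1) * q\<close> vary inside the statement, so all matrices are
  dimension-carrying complex matrices with explicit carriers.
  A matrix polynomial \<open>A\<^sub>0 z\<^sup>n + A\<^sub>1 z\<^sup>n\<^sup>-\<^sup>1 + \<dots> + A\<^sub>n\<close> is given by its degree \<open>n\<close> and the
  coefficient sequence \<open>A :: nat \<Rightarrow> complex mat\<close>, of which only \<open>A 0, \<dots>, A n\<close> matter.
\<close>

text \<open>The value is unspecified if the matrix is singular.\<close>

definition minv :: "complex mat \<Rightarrow> complex mat" where
  "minv M = the (mat_inverse M)"

definition herm_pos_def :: "nat \<Rightarrow> complex mat \<Rightarrow> bool" where
  "herm_pos_def N M \<longleftrightarrow> M \<in> carrier_mat N N \<and> mat_adjoint M = M \<and>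
     (\<forall>v\<in>carrier_vec N. v \<noteq> 0\<^sub>v N \<longrightarrow> Re ((M *\<^sub>v v) \<bullet>c v) > 0)"

text \<open>\<open>mat_sum q f k\<close> is \<open>f 0 + \<dots> + f (k - 1)\<close> (the type of matrices of arbitrary size is not
  an instance of \<^class>\<open>comm_monoid_add\<close>, so \<^const>\<open>sum\<close> is not available).\<close>

primrec mat_sum :: "nat \<Rightarrow> (nat \<Rightarrow> complex mat) \<Rightarrow> nat \<Rightarrow> complex mat" where
  "mat_sum q f 0 = 0\<^sub>m q q"
| "mat_sum q f (Suc k) = mat_sum q f k + f k"

text \<open>The \<open>r \<times> c\<close> block matrix with \<open>q \<times> q\<close> blocks \<open>F a b\<close>.\<close>

definition block_mat :: "nat \<Rightarrow> nat \<Rightarrow> nat \<Rightarrow> (nat \<Rightarrow> nat \<Rightarrow> complex mat) \<Rightarrow> complex mat" where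
  "block_mat q r c F =
     mat (r * q) (c * q) (\<lambda>(i, k). F (i div q) (k div q) $$ (i mod q, k mod q))"

text \<open>The block row \<open>(M, N)\<close>, the column analogue of \<^const>\<open>append_rows\<close>.\<close>

definition append_cols :: "complex mat \<Rightarrow> complex mat \<Rightarrow> complex mat" where
  "append_cols M N = four_block_mat M N (0\<^sub>m 0 (dim_col M)) (0\<^sub>m 0 (dim_col N))"

definition mpoly_eval :: "nat \<Rightarrow> nat \<Rightarrow> (nat \<Rightarrow> complex mat) \<Rightarrow> complex \<Rightarrow> complex mat" where
  "mpoly_eval q n A z = mat_sum q (\<lambda>j. z ^ (n - j) \<cdot>\<^sub>m A j) (Suc n)"

definition h_part :: "nat \<Rightarrow> nat \<Rightarrow> (nat \<Rightarrow> complex mat) \<Rightarrow> complex \<Rightarrow> complex mat" where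
  "h_part q n A z = (let m = n div 2 in
     if even n then mat_sum q (\<lambda>l. z ^ (m - l) \<cdot>\<^sub>m A (2 * l)) (m + 1)
     else mat_sum q (\<lambda>l. z ^ (m - l) \<cdot>\<^sub>m A (2 * l + 1)) (m + 1))"

definition g_part :: "nat \<Rightarrow> nat \<Rightarrow> (nat \<Rightarrow> complex mat) \<Rightarrow> complex \<Rightarrow> complex mat" where
  "g_part q n A z = (let m = n div 2 in
     if even n then mat_sum q (\<lambda>l. z ^ (m - 1 - l) \<cdot>\<^sub>m A (2 * l + 1)) m
     else mat_sum q (\<lambda>l. z ^ (m - l) \<cdot>\<^sub>m A (2 * l)) (m + 1))"

lemma mat_sum_carrier:
  assumes "\<And>l. l < k \<Longrightarrow> f l \<in> carrier_mat q q"
  shows "mat_sum q f k \<in> carrier_mat q q"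
  using assms by (induction k) auto

lemma mat_sum_index:
  assumes "\<And>l. l < k \<Longrightarrow> f l \<in> carrier_mat q q" and "a < q" "b < q"
  shows "mat_sum q f k $$ (a, b) = (\<Sum>l<k. f l $$ (a, b))"
  using assms
proof (induction k)
  case (Suc k)
  have "dim_row (f k) = q" "dim_col (f k) = q" using Suc.prems(1)[of k] by auto
  then show ?case using Suc by simp
qed simp

lemma sum_even_odd_split:
  fixes f :: "nat \<Rightarrow> complex"
  shows "(\<Sum>j<2 * m. f j) = (\<Sum>l<m. f (2 * l)) + (\<Sum>l<m. f (2 * l + 1))"
  by (induction m) (simp_all add: algebra_simps)

lemma mpoly_eval_split:
  assumes A: "\<And>j. j \<le> n \<Longrightarrow> A j \<in> carrier_mat q q"
  shows "mpoly_eval q n A z = h_part q n A (z\<^sup>2) + z \<cdot>\<^sub>m g_part q n A (z\<^sup>2)"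
proof (rule eq_matI)
  define m where "m = n div 2"
  have hc: "h_part q n A w \<in> carrier_mat q q" and gc: "g_part q n A w \<in> carrier_mat q q" for w
    using A by (auto simp: h_part_def g_part_def Let_def simp del: mat_sum.simps
        intro!: mat_sum_carrier smult_carrier_mat elim!: evenE oddE)
  have fc: "mpoly_eval q n A z \<in> carrier_mat q q"
    using A unfolding mpoly_eval_def by (intro mat_sum_carrier smult_carrier_mat) auto
  show "dim_row (mpoly_eval q n A z) = dim_row (h_part q n A (z\<^sup>2) + z \<cdot>\<^sub>m g_part q n A (z\<^sup>2))"
    and "dim_col (mpoly_eval q n A z) = dim_col (h_part q n A (z\<^sup>2) + z \<cdot>\<^sub>m g_part q n A (z\<^sup>2))"
    using fc hc[of "z\<^sup>2"] gc[of "z\<^sup>2"] by auto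
  fix a b
  assume "a < dim_row (h_part q n A (z\<^sup>2) + z \<cdot>\<^sub>m g_part q n A (z\<^sup>2))"
    and "b < dim_col (h_part q n A (z\<^sup>2) + z \<cdot>\<^sub>m g_part q n A (z\<^sup>2))"
  then have ab: "a < q" "b < q" using gc[of "z\<^sup>2"] by auto
  have idx: "(w ^ e \<cdot>\<^sub>m A j) $$ (a, b) = w ^ e * A j $$ (a, b)" if "j \<le> n" for w e j
    using A[OF that] ab by simp
  have L: "mpoly_eval q n A z $$ (a, b) = (\<Sum>j<Suc n. z ^ (n - j) * A j $$ (a, b))"
    unfolding mpoly_eval_def using A ab
    by (subst mat_sum_index) (auto simp: idx simp del: index_smult_mat intro!: sum.cong)
  have R: "(h_part q n A (z\<^sup>2) + z \<cdot>\<^sub>m g_part q n A (z\<^sup>2)) $$ (a, b)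
      = h_part q n A (z\<^sup>2) $$ (a, b) + z * g_part q n A (z\<^sup>2) $$ (a, b)"
    using hc[of "z\<^sup>2"] gc[of "z\<^sup>2"] ab by simp
  show "mpoly_eval q n A z $$ (a, b) = (h_part q n A (z\<^sup>2) + z \<cdot>\<^sub>m g_part q n A (z\<^sup>2)) $$ (a, b)"
  proof (cases "even n")
    case True
    then have n: "n = 2 * m" by (simp add: m_def)
    have h: "h_part q n A (z\<^sup>2) $$ (a, b) = (\<Sum>l<Suc m. z ^ (n - 2 * l) * A (2 * l) $$ (a, b))"
      unfolding h_part_def Let_def using True A ab n
      by (subst if_P, simp, subst mat_sum_index)
         (auto simp: idx power_mult[symmetric] diff_mult_distrib2 simp del: index_smult_mat
           intro!: sum.cong)
    have g: "z * g_part q n A (z\<^sup>2) $$ (a, b)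
        = (\<Sum>l<m. z ^ (n - (2 * l + 1)) * A (2 * l + 1) $$ (a, b))"
    proof -
      have e: "z * z ^ (2 * (m - Suc l)) = z ^ (n - Suc (2 * l))" if "l < m" for l
      proof -
        have "n - Suc (2 * l) = Suc (2 * (m - Suc l))" using that n by simp
        then show ?thesis by (simp only: power_Suc)
      qed
      show ?thesis
        unfolding g_part_def Let_def using True A ab n
        by (subst if_P, simp, subst mat_sum_index)
           (auto simp: idx power_mult[symmetric] sum_distrib_left mult.assoc[symmetric] e
             simp del: index_smult_mat intro!: sum.cong)
    qed
    have "(\<Sum>j<Suc n. z ^ (n - j) * A j $$ (a, b))
        = (\<Sum>j<2 * m. z ^ (n - j) * A j $$ (a, b)) + z ^ (n - 2 * m) * A (2 * m) $$ (a, b)"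
      using n by simp
    then show ?thesis unfolding L R h g by (subst (asm) sum_even_odd_split) simp
  next
    case False
    then have n: "n = 2 * m + 1" by (simp add: m_def)
    have h: "h_part q n A (z\<^sup>2) $$ (a, b)
        = (\<Sum>l<Suc m. z ^ (n - (2 * l + 1)) * A (2 * l + 1) $$ (a, b))"
      unfolding h_part_def Let_def using False A ab n
      by (subst if_not_P, simp, subst mat_sum_index)
         (auto simp: idx power_mult[symmetric] diff_mult_distrib2 simp del: index_smult_mat
           intro!: sum.cong)
    have g: "z * g_part q n A (z\<^sup>2) $$ (a, b)
        = (\<Sum>l<Suc m. z ^ (n - 2 * l) * A (2 * l) $$ (a, b))"
    proof -
      have e: "z * z ^ (2 * (m - l)) = z ^ (n - 2 * l)" if "l < Suc m" for l
      proof -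
        have "n - 2 * l = Suc (2 * (m - l))" using that n by simp
        then show ?thesis by (simp only: power_Suc)
      qed
      show ?thesis
        unfolding g_part_def Let_def using False A ab n
        by (subst if_not_P, simp, subst mat_sum_index)
           (auto simp: idx power_mult[symmetric] sum_distrib_left mult.assoc[symmetric] e
             simp del: index_smult_mat sum.lessThan_Suc intro!: sum.cong)
    qed
    have "(\<Sum>j<Suc n. z ^ (n - j) * A j $$ (a, b)) = (\<Sum>j<2 * Suc m. z ^ (n - j) * A j $$ (a, b))"
      using n by simp
    then show ?thesis unfolding L R h g by (subst (asm) sum_even_odd_split) simp
  qed
qed

text \<open>Rational matrix functions are represented by their pointwise values, which are meaningful
  off the finitely many points where one of the inverted matrices is singular; they are identical
  iff they agree at all but finitely many points. The polynomial inverted here is monic up to a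
  factor \<open>z\<close>, hence regular at all but finitely many points.\<close>

definition gh_ratio :: "nat \<Rightarrow> nat \<Rightarrow> (nat \<Rightarrow> complex mat) \<Rightarrow> complex \<Rightarrow> complex mat" where
  "gh_ratio q n A z =
     (if even n then g_part q n A z * minv (h_part q n A z)
      else h_part q n A z * minv (z \<cdot>\<^sub>m g_part q n A z))"

text \<open>The equations below determine \<open>K 0, \<dots>, K m\<close> (\<open>K 0, \<dots>, K (m - 1)\<close> for even \<open>n\<close>) uniquely
  from the positive definite parameters \<open>c\<close> and \<open>d\<close>; all matrices inverted in them are regular for
  \<open>z > 0\<close>, hence for all but finitely many \<open>z\<close>.\<close>

definition HTM_poly :: "nat \<Rightarrow> nat \<Rightarrow> (nat \<Rightarrow> complex mat) \<Rightarrow> bool" where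
  "HTM_poly q n A \<longleftrightarrow> (let m = n div 2 in \<exists>c d. \<exists>K :: nat \<Rightarrow> complex \<Rightarrow> complex mat.
     (if even n then
        (\<forall>i<m. herm_pos_def q (c i)) \<and> (\<forall>i<m. herm_pos_def q (d i)) \<and>
        (\<forall>z. K (m - 1) z = minv (z \<cdot>\<^sub>m c (m - 1) + minv (d (m - 1)))) \<and>
        (\<forall>i. i + 1 < m \<longrightarrow>
           (\<forall>z. K i z = minv (z \<cdot>\<^sub>m c i + minv (d i + K (i + 1) z))))
      else
        (\<forall>i\<le>m. herm_pos_def q (c i)) \<and> (\<forall>i<m. herm_pos_def q (d i)) \<and>
        (\<forall>z. K m z = inverse z \<cdot>\<^sub>m minv (c m)) \<and>
        (\<forall>i<m. \<forall>z. K i z = minv (z \<cdot>\<^sub>m c i + minv (d i + K (i + 1) z)))) \<and>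
     (\<forall>\<^sub>F z in cofinite. gh_ratio q n A z = K 0 z))"

text \<open>\<open>s\<close> is the sequence of coefficients of the Laurent expansion at infinity
  \<open>\<Sum>j. (-1)\<^sup>j s\<^sub>j z\<^sup>-\<^sup>j\<^sup>-\<^sup>1\<close>, which is required entry by entry for all sufficiently large \<open>\<bar>z\<bar>\<close>.\<close>

definition markov_params :: "nat \<Rightarrow> nat \<Rightarrow> (nat \<Rightarrow> complex mat) \<Rightarrow> (nat \<Rightarrow> complex mat) \<Rightarrow> bool" where
  "markov_params q n A s \<longleftrightarrow> (\<forall>j. s j \<in> carrier_mat q q) \<and>
     (\<forall>\<^sub>F z in at_infinity. \<forall>a<q. \<forall>b<q.
        (\<lambda>j. (- 1) ^ j * s j $$ (a, b) * inverse z ^ (j + 1)) sums (gh_ratio q n A z $$ (a, b)))"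

definition H1 :: "nat \<Rightarrow> (nat \<Rightarrow> complex mat) \<Rightarrow> nat \<Rightarrow> complex mat" where
  "H1 q s j = block_mat q (j + 1) (j + 1) (\<lambda>a b. s (a + b))"

definition H2 :: "nat \<Rightarrow> (nat \<Rightarrow> complex mat) \<Rightarrow> nat \<Rightarrow> complex mat" where
  "H2 q s j = block_mat q (j + 1) (j + 1) (\<lambda>a b. s (a + b + 1))"

text \<open>Positivity of the finite sequence \<open>s 0, \<dots>, s \<kappa>\<close>.\<close>

definition stieltjes_positive :: "nat \<Rightarrow> (nat \<Rightarrow> complex mat) \<Rightarrow> nat \<Rightarrow> bool" where
  "stieltjes_positive q s \<kappa> \<longleftrightarrow>
     (\<forall>j. 2 * j \<le> \<kappa> \<longrightarrow> herm_pos_def ((j + 1) * q) (H1 q s j)) \<and>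
     (\<forall>j. 2 * j + 1 \<le> \<kappa> \<longrightarrow> herm_pos_def ((j + 1) * q) (H2 q s j))"

text \<open>\<open>y_seg q s j k\<close> is the block column \<open>(s j, s (j + 1), \<dots>, s k)\<^sup>*\<close>, for \<open>j \<le> k\<close>.\<close>

definition y_seg :: "nat \<Rightarrow> (nat \<Rightarrow> complex mat) \<Rightarrow> nat \<Rightarrow> nat \<Rightarrow> complex mat" where
  "y_seg q s j k = mat_adjoint (block_mat q 1 (k + 1 - j) (\<lambda>a b. s (j + b)))"

definition Y1 :: "nat \<Rightarrow> (nat \<Rightarrow> complex mat) \<Rightarrow> nat \<Rightarrow> complex mat" where
  "Y1 q s j = y_seg q s j (2 * j - 1)"

definition Y2 :: "nat \<Rightarrow> (nat \<Rightarrow> complex mat) \<Rightarrow> nat \<Rightarrow> complex mat" where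
  "Y2 q s j = y_seg q s (j + 1) (2 * j)"

definition H1hat :: "nat \<Rightarrow> (nat \<Rightarrow> complex mat) \<Rightarrow> nat \<Rightarrow> complex mat" where
  "H1hat q s j = (if j = 0 then s 0
     else s (2 * j) - mat_adjoint (Y1 q s j) * minv (H1 q s (j - 1)) * Y1 q s j)"

definition H2hat :: "nat \<Rightarrow> (nat \<Rightarrow> complex mat) \<Rightarrow> nat \<Rightarrow> complex mat" where
  "H2hat q s j = (if j = 0 then s 1
     else s (2 * j + 1) - mat_adjoint (Y2 q s j) * minv (H2 q s (j - 1)) * Y2 q s j)"

definition Tmat :: "nat \<Rightarrow> nat \<Rightarrow> complex mat" where
  "Tmat q j = (if j = 0 then 0\<^sub>m q q
     else four_block_mat (0\<^sub>m q (j * q)) (0\<^sub>m q q) (1\<^sub>m (j * q)) (0\<^sub>m (j * q) q))"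

definition Rmat :: "nat \<Rightarrow> nat \<Rightarrow> complex \<Rightarrow> complex mat" where
  "Rmat q j z = minv (1\<^sub>m ((j + 1) * q) - z \<cdot>\<^sub>m Tmat q j)"

definition vmat :: "nat \<Rightarrow> nat \<Rightarrow> complex mat" where
  "vmat q j = (if j = 0 then 1\<^sub>m q else 1\<^sub>m q @\<^sub>r 0\<^sub>m (j * q) q)"

definition u2 :: "nat \<Rightarrow> (nat \<Rightarrow> complex mat) \<Rightarrow> nat \<Rightarrow> complex mat" where
  "u2 q s j = - y_seg q s 0 j"

definition P1 :: "nat \<Rightarrow> (nat \<Rightarrow> complex mat) \<Rightarrow> nat \<Rightarrow> complex \<Rightarrow> complex mat" where
  "P1 q s j z = (if j = 0 then 1\<^sub>m q
     else append_cols (- (mat_adjoint (Y1 q s j) * minv (H1 q s (j - 1)))) (1\<^sub>m q)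
            * Rmat q j z * vmat q j)"

definition Q2 :: "nat \<Rightarrow> (nat \<Rightarrow> complex mat) \<Rightarrow> nat \<Rightarrow> complex \<Rightarrow> complex mat" where
  "Q2 q s j z = (if j = 0 then s 0
     else - (append_cols (- (mat_adjoint (Y2 q s j) * minv (H2 q s (j - 1)))) (1\<^sub>m q)
            * Rmat q j z * u2 q s j))"

definition P1_0 :: "nat \<Rightarrow> (nat \<Rightarrow> complex mat) \<Rightarrow> nat \<Rightarrow> complex mat" where
  "P1_0 q s r = mat_adjoint (P1 q s r 0) * minv (H1hat q s r) * P1 q s r 0"

definition Q2_0 :: "nat \<Rightarrow> (nat \<Rightarrow> complex mat) \<Rightarrow> nat \<Rightarrow> complex mat" where
  "Q2_0 q s r = mat_adjoint (Q2 q s r 0) * minv (H2hat q s r) * Q2 q s r 0"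

text \<open>\<open>Xi q s j m\<close> is \<open>\<Xi>\<^sub>m\<close> with upper index \<open>j\<close>, and similarly for the other three.\<close>

function (sequential)
  Xi :: "nat \<Rightarrow> (nat \<Rightarrow> complex mat) \<Rightarrow> nat \<Rightarrow> nat \<Rightarrow> complex mat" and
  Phi :: "nat \<Rightarrow> (nat \<Rightarrow> complex mat) \<Rightarrow> nat \<Rightarrow> nat \<Rightarrow> complex mat" and
  Theta :: "nat \<Rightarrow> (nat \<Rightarrow> complex mat) \<Rightarrow> nat \<Rightarrow> nat \<Rightarrow> complex mat" and
  Psi :: "nat \<Rightarrow> (nat \<Rightarrow> complex mat) \<Rightarrow> nat \<Rightarrow> nat \<Rightarrow> complex mat"
where
  "Xi q s 0 m = 1\<^sub>m q"
| "Xi q s (Suc j) m = mat_sum q (\<lambda>l. Psi q s j l * P1_0 q s l) (m + 1)"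
| "Phi q s 0 m = 1\<^sub>m q"
| "Phi q s (Suc j) m = mat_sum q (\<lambda>l. Theta q s j l * Q2_0 q s l) m"
| "Theta q s 0 m = mat_sum q (\<lambda>l. P1_0 q s l) (m + 1)"
| "Theta q s (Suc j) m = mat_sum q (\<lambda>l. Phi q s (Suc j) l * P1_0 q s l) (m + 1)"
| "Psi q s 0 m = mat_sum q (\<lambda>l. Q2_0 q s l) m"
| "Psi q s (Suc j) m = mat_sum q (\<lambda>l. Xi q s (Suc j) l * Q2_0 q s l) m"
  by pat_completeness auto
termination
  by (relation "measure (case_sum
        (case_sum (\<lambda>(q, s, j, m). 2 * j) (\<lambda>(q, s, j, m). 2 * j))
        (case_sum (\<lambda>(q, s, j, m). 2 * j + 1) (\<lambda>(q, s, j, m). 2 * j + 1)))") auto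

text \<open>\<open>even_prod q s m\<close> is the product over \<open>i = 0, \<dots>, m - 1\<close>, in this order, of
  \<open>H1hat\<^sub>i\<^sup>-\<^sup>1 H2hat\<^sub>i\<close>; \<open>odd_prod q s m\<close> is
  \<open>H1hat\<^sub>0 H2hat\<^sub>0\<^sup>-\<^sup>1 H1hat\<^sub>1 \<dots> H2hat\<^sub>m\<^sub>-\<^sub>1\<^sup>-\<^sup>1 H1hat\<^sub>m\<close>.\<close>

primrec even_prod :: "nat \<Rightarrow> (nat \<Rightarrow> complex mat) \<Rightarrow> nat \<Rightarrow> complex mat" where
  "even_prod q s 0 = 1\<^sub>m q"
| "even_prod q s (Suc i) = even_prod q s i * minv (H1hat q s i) * H2hat q s i"

primrec odd_prod :: "nat \<Rightarrow> (nat \<Rightarrow> complex mat) \<Rightarrow> nat \<Rightarrow> complex mat" where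
  "odd_prod q s 0 = H1hat q s 0"
| "odd_prod q s (Suc i) = odd_prod q s i * minv (H2hat q s i) * H1hat q s (Suc i)"

end

theory Submission
  imports Defs
begin

text \<open>
  Let \<open>S(z)\<close> be the moment series \<open>\<Sum>\<^sub>j (-1)\<^sup>j s\<^sub>j z\<^sup>-\<^sup>j\<^sup>-\<^sup>1\<close>, and let \<open>h\<close>, \<open>g\<close> be the two parts of the given
  polynomial. The Markov parameters satisfy \<open>S h = g\<close> for \<open>n = 2m\<close> and \<open>z S g = h\<close> for
  \<open>n = 2m + 1\<close>. In the first case \<open>h\<close>, in the second case \<open>g\<close>, is monic of degree \<open>m\<close>, and its
  product with the series has no negative powers of \<open>z\<close>. Up to signs, the vanishing of the first
  \<open>m\<close> of these Laurent coefficients is orthogonality with respect to a block Hankel matrix, a linear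
  system for the lower coefficients whose matrix \<open>H1\<close> or \<open>H2\<close> with index \<open>m - 1\<close> is positive
  definite. So only one monic polynomial of degree \<open>m\<close> is possible (\<open>monic_orthogonal_unique\<close>),
  and the other part is the polynomial part of the product. It remains to recognise this solution.

  Collect the four families into matrix polynomials \<open>\<Phi>\<^sub>m(z) = \<Sum>\<^sub>j Phi q s j m z\<^sup>j\<close>, and likewise
  \<open>\<Psi>\<^sub>m\<close>, \<open>\<Theta>\<^sub>m\<close>, \<open>\<Xi>\<^sub>m\<close>. With the weights \<open>M\<^sub>l = P1_0 q s l\<close> and \<open>L\<^sub>l = Q2_0 q s l\<close> their
  definitions read

    \<open>\<Phi>\<^sub>m\<^sub>+\<^sub>1 = \<Phi>\<^sub>m + z \<Theta>\<^sub>m L\<^sub>m\<close>, \<open>\<Psi>\<^sub>m\<^sub>+\<^sub>1 = \<Psi>\<^sub>m + \<Xi>\<^sub>m L\<^sub>m\<close>,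
    \<open>\<Theta>\<^sub>m = \<Theta>\<^sub>m\<^sub>-\<^sub>1 + \<Phi>\<^sub>m M\<^sub>m\<close>, \<open>\<Xi>\<^sub>m = \<Xi>\<^sub>m\<^sub>-\<^sub>1 + z \<Psi>\<^sub>m M\<^sub>m\<close>,

  with \<open>\<Theta>\<^sub>-\<^sub>1 = 0\<close> and \<open>\<Xi>\<^sub>-\<^sub>1 = I\<close>: the recurrences of a Stieltjes continued fraction. Hence the remainders \<open>\<rho>\<^sub>m = S \<Phi>\<^sub>m - \<Psi>\<^sub>m\<close> and
  \<open>\<sigma>\<^sub>m = z S \<Theta>\<^sub>m - \<Xi>\<^sub>m\<close> satisfy \<open>\<rho>\<^sub>m\<^sub>+\<^sub>1 = \<rho>\<^sub>m + \<sigma>\<^sub>m L\<^sub>m\<close> and \<open>\<sigma>\<^sub>m = \<sigma>\<^sub>m\<^sub>-\<^sub>1 + z \<rho>\<^sub>m M\<^sub>m\<close>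
  (\<open>laurent_coeff_Phi_Suc\<close>, \<open>laurent_coeff_Theta_Suc\<close>), and the claim is that each step gains one
  order at infinity: \<open>\<rho>\<^sub>m\<close> and \<open>\<sigma>\<^sub>m\<close> both begin with the power \<open>-m - 1\<close> of \<open>z\<close>.

  Put \<open>E\<^sub>m = even_prod q s m\<close> and \<open>D\<^sub>m = odd_prod q s m\<close>. These products alternate so that
  \<open>D\<^sub>m\<^sup>* E\<^sub>m = H1hat\<^sub>m\<close> and \<open>D\<^sub>m\<^sup>* E\<^sub>m\<^sub>+\<^sub>1 = H2hat\<^sub>m\<close>. The polynomial \<open>\<Phi>\<^sub>m E\<^sub>m\<close> is monic with constant
  coefficient \<open>E\<^sub>m\<close>. By its orthogonality the constant coefficient is \<open>P1\<^sub>m(0)\<^sup>*\<close> up to sign, and the first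
  nonvanishing Laurent coefficient of \<open>S \<Phi>\<^sub>m E\<^sub>m\<close> is the Schur complement \<open>H1hat\<^sub>m\<close>
  (\<open>even_orthogonal\<close>). Therefore \<open>M\<^sub>m = E\<^sub>m H1hat\<^sub>m\<^sup>-\<^sup>1 E\<^sub>m\<^sup>* = E\<^sub>m D\<^sub>m\<^sup>-\<^sup>1\<close>, and \<open>\<rho>\<^sub>m\<close> begins with
  \<open>D\<^sub>m\<^sup>*\<close>. In the same way \<open>L\<^sub>m = D\<^sub>m E\<^sub>m\<^sub>+\<^sub>1\<^sup>-\<^sup>1\<close>, and \<open>\<sigma>\<^sub>m\<close> begins with \<open>- E\<^sub>m\<^sub>+\<^sub>1\<^sup>*\<close>
  (\<open>odd_orthogonal\<close>). The weights are Hermitian, so \<open>D\<^sub>m\<^sup>* M\<^sub>m = E\<^sub>m\<^sup>*\<close> and \<open>E\<^sub>m\<^sub>+\<^sub>1\<^sup>* L\<^sub>m = D\<^sub>m\<^sup>*\<close>: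
  in each recurrence the leading coefficients cancel, which carries the induction
  (\<open>Stieltjes_even_odd\<close>).
\<close>

section \<open>Matrix arithmetic and adjoints\<close>

lemma mult_carrier_square [intro]:
  "A \<in> carrier_mat q q \<Longrightarrow> B \<in> carrier_mat q q \<Longrightarrow> A * B \<in> carrier_mat q q"
  by (rule mult_carrier_mat)

lemma smult_smult_mat: "a \<cdot>\<^sub>m (b \<cdot>\<^sub>m X) = (a * b) \<cdot>\<^sub>m (X :: complex mat)"
  by (rule eq_matI) auto

lemma one_smult_mat: "1 \<cdot>\<^sub>m X = (X :: complex mat)"
  by (rule eq_matI) auto

lemma right_cancel_mat:
  assumes "X * E = Y * (E :: complex mat)" "E * F = 1\<^sub>m q"
    and "X \<in> carrier_mat q q" "Y \<in> carrier_mat q q" "E \<in> carrier_mat q q" "F \<in> carrier_mat q q"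
  shows "X = Y"
proof -
  have "X = X * E * F" using assms(2-) by (simp add: assoc_mult_mat[of _ q q _ q _ q])
  also have "\<dots> = Y * E * F" using assms(1) by simp
  also have "\<dots> = Y" using assms(2-) by (simp add: assoc_mult_mat[of _ q q _ q _ q])
  finally show ?thesis .
qed

lemma add_eq_zero_mat:
  fixes X Y :: "complex mat"
  assumes "X + Y = 0\<^sub>m n m" "X \<in> carrier_mat n m" "Y \<in> carrier_mat n m"
  shows "X = - Y"
proof (rule eq_matI)
  fix i j assume "i < dim_row (- Y)" "j < dim_col (- Y)"
  then have ij: "i < n" "j < m" using assms by auto
  have "X $$ (i, j) + Y $$ (i, j) = (X + Y) $$ (i, j)" using assms(2,3) ij by simp
  also have "\<dots> = 0" unfolding assms(1) using ij by simp
  finally show "X $$ (i, j) = (- Y) $$ (i, j)"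
    using assms(2,3) ij by (simp add: eq_neg_iff_add_eq_0)
qed (use assms in auto)

lemma add_uminus_self_mat:
  fixes X :: "complex mat"
  assumes "X \<in> carrier_mat n m"
  shows "X + - X = 0\<^sub>m n m" "- X + X = 0\<^sub>m n m"
  using assms by (auto intro!: eq_matI)

lemma adjoint_carrier [intro]: "A \<in> carrier_mat n m \<Longrightarrow> mat_adjoint A \<in> carrier_mat m n"
  by (auto simp: mat_adjoint_def)

lemma adjoint_dim [simp]: "dim_row (mat_adjoint A) = dim_col A" "dim_col (mat_adjoint A) = dim_row A"
  for A :: "complex mat"
  by (auto simp: mat_adjoint_def)

lemma adjoint_index [simp]:
  "i < dim_col A \<Longrightarrow> j < dim_row A \<Longrightarrow> mat_adjoint A $$ (i, j) = cnj (A $$ (j, i))"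
  by (auto simp: mat_adjoint_def mat_of_rows_def)

lemma adjoint_adjoint [simp]: "mat_adjoint (mat_adjoint A) = (A :: complex mat)"
  by (rule eq_matI) auto

lemma adjoint_mult:
  assumes "A \<in> carrier_mat n m" "B \<in> carrier_mat m p"
  shows "mat_adjoint (A * B) = mat_adjoint B * mat_adjoint (A :: complex mat)"
  using assms by (intro eq_matI) (auto simp: scalar_prod_def mult.commute)

lemma adjoint_smult: "mat_adjoint (c \<cdot>\<^sub>m A) = cnj c \<cdot>\<^sub>m mat_adjoint A"
  by (rule eq_matI) auto

lemma adjoint_uminus: "mat_adjoint (- A) = - mat_adjoint (A :: complex mat)"
  by (rule eq_matI) auto

lemma adjoint_one [simp]: "mat_adjoint (1\<^sub>m n) = (1\<^sub>m n :: complex mat)"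
  by (rule eq_matI) auto

lemma adjoint_product_hermitian:
  fixes X Y H :: "complex mat"
  assumes "X \<in> carrier_mat q q" "Y \<in> carrier_mat q q"
    and "mat_adjoint X * Y = H" "mat_adjoint H = H"
  shows "mat_adjoint Y * X = H"
proof -
  have "mat_adjoint Y * X = mat_adjoint (mat_adjoint X * Y)"
    using adjoint_mult[OF adjoint_carrier[OF assms(1)] assms(2)] by simp
  then show ?thesis by (simp only: assms)
qed

section \<open>Inverses and positive definiteness\<close>

lemma minv_eqI:
  assumes "M \<in> carrier_mat N N" "B \<in> carrier_mat N N" "M * B = 1\<^sub>m N"
  shows "minv M = B"
proof -
  have BM: "B * M = 1\<^sub>m N" using mat_mult_left_right_inverse assms by blast
  have "M \<in> Units (ring_mat TYPE(complex) N ())"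
    using assms BM by (auto simp: Units_def ring_mat_def)
  then obtain C where C: "mat_inverse M = Some C"
    using mat_inverse(1)[OF assms(1), of "()"] by (cases "mat_inverse M") auto
  have "M * C = 1\<^sub>m N" "C * M = 1\<^sub>m N" "C \<in> carrier_mat N N"
    using mat_inverse(2)[OF assms(1) C] by auto
  then have "C = C * (M * B)" "(C * M) * B = B"
    using assms by auto
  moreover have "C * (M * B) = (C * M) * B"
    using assms \<open>C \<in> carrier_mat N N\<close> by (intro assoc_mult_mat[symmetric]) auto
  ultimately show ?thesis by (simp add: minv_def C)
qed

lemma minv_if_det_nonzero:
  assumes M: "M \<in> carrier_mat N N" and "det M \<noteq> 0"
  shows "minv M \<in> carrier_mat N N" "M * minv M = 1\<^sub>m N" "minv M * M = 1\<^sub>m N"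
proof -
  have "M \<in> Units (ring_mat TYPE(complex) N ())"
    by (rule det_non_zero_imp_unit[OF assms])
  then obtain C where C: "mat_inverse M = Some C"
    using mat_inverse(1)[OF M, of "()"] by (cases "mat_inverse M") auto
  then show "minv M \<in> carrier_mat N N" "M * minv M = 1\<^sub>m N" "minv M * M = 1\<^sub>m N"
    using mat_inverse(2)[OF M C] by (auto simp: minv_def)
qed

lemma minv_pos_def:
  assumes "herm_pos_def N M"
  shows "minv M \<in> carrier_mat N N" "M * minv M = 1\<^sub>m N" "minv M * M = 1\<^sub>m N"
    and "mat_adjoint (minv M) = minv M"
proof -
  have M: "M \<in> carrier_mat N N" and herm: "mat_adjoint M = M"
    and pos: "\<And>v. v \<in> carrier_vec N \<Longrightarrow> v \<noteq> 0\<^sub>v N \<Longrightarrow> Re ((M *\<^sub>v v) \<bullet>c v) > 0"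
    using assms by (auto simp: herm_pos_def_def)
  have "det M \<noteq> 0"
  proof
    assume "det M = 0"
    then obtain v where v: "v \<in> carrier_vec N" "v \<noteq> 0\<^sub>v N" "M *\<^sub>v v = 0\<^sub>v N"
      using det_0_iff_vec_prod_zero_field[OF M] by auto
    have "conjugate v \<in> carrier_vec N" using v(1) by auto
    then have "(M *\<^sub>v v) \<bullet>c v = 0" unfolding v(3) by simp
    then show False using pos[OF v(1,2)] by simp
  qed
  note inv = minv_if_det_nonzero[OF M this]
  show "minv M \<in> carrier_mat N N" "M * minv M = 1\<^sub>m N" "minv M * M = 1\<^sub>m N" using inv by auto
  have "M * mat_adjoint (minv M) = mat_adjoint (minv M * M)"
    using adjoint_mult[OF inv(1) M] herm by simp
  also have "\<dots> = 1\<^sub>m N" using inv by simp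
  finally show "mat_adjoint (minv M) = minv M"
    by (rule minv_eqI[OF M adjoint_carrier[OF inv(1)], symmetric])
qed

lemma adjoint_cscalar_prod:
  fixes W :: "complex mat"
  assumes W: "W \<in> carrier_mat n m" and u: "u \<in> carrier_vec n" and v: "v \<in> carrier_vec m"
  shows "(mat_adjoint W *\<^sub>v u) \<bullet>c v = u \<bullet>c (W *\<^sub>v v)"
proof -
  have dims: "dim_row W = n" "dim_col W = m" "dim_vec u = n" "dim_vec v = m"
    using assms by auto
  have Wu: "(mat_adjoint W *\<^sub>v u) $ i = (\<Sum>j<n. cnj (W $$ (j, i)) * u $ j)" if "i < m" for i
    using that dims by (simp add: scalar_prod_def atLeast0LessThan)
  have Wv: "(W *\<^sub>v v) $ j = (\<Sum>i<m. W $$ (j, i) * v $ i)" if "j < n" for j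
    using that dims by (simp add: scalar_prod_def atLeast0LessThan)
  have "(mat_adjoint W *\<^sub>v u) \<bullet>c v = (\<Sum>i<m. (mat_adjoint W *\<^sub>v u) $ i * cnj (v $ i))"
    using dims by (simp add: scalar_prod_def atLeast0LessThan)
  also have "\<dots> = (\<Sum>i<m. \<Sum>j<n. cnj (W $$ (j, i)) * u $ j * cnj (v $ i))"
    by (simp add: Wu sum_distrib_right)
  also have "\<dots> = (\<Sum>j<n. \<Sum>i<m. cnj (W $$ (j, i)) * u $ j * cnj (v $ i))"
    by (rule sum.swap)
  also have "\<dots> = (\<Sum>j<n. u $ j * cnj ((W *\<^sub>v v) $ j))"
    by (simp add: Wv sum_distrib_left mult_ac)
  also have "\<dots> = u \<bullet>c (W *\<^sub>v v)"
    using dims by (simp add: scalar_prod_def atLeast0LessThan)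
  finally show ?thesis .
qed

lemma herm_pos_def_congruence:
  assumes M: "herm_pos_def N M" and W: "W \<in> carrier_mat N p"
    and inj: "\<And>v. v \<in> carrier_vec p \<Longrightarrow> W *\<^sub>v v = 0\<^sub>v N \<Longrightarrow> v = 0\<^sub>v p"
  shows "herm_pos_def p (mat_adjoint W * (M * W))"
proof -
  have Mc: "M \<in> carrier_mat N N" and herm: "mat_adjoint M = M"
    and pos: "\<And>v. v \<in> carrier_vec N \<Longrightarrow> v \<noteq> 0\<^sub>v N \<Longrightarrow> Re ((M *\<^sub>v v) \<bullet>c v) > 0"
    using M by (auto simp: herm_pos_def_def)
  have W': "mat_adjoint W \<in> carrier_mat p N" using W by auto
  have "mat_adjoint (mat_adjoint W * (M * W)) = mat_adjoint W * (M * W)"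
    using W W' Mc herm by (simp add: adjoint_mult[of _ p N _ p] adjoint_mult[of _ N N _ p]
        assoc_mult_mat[of _ p N _ N _ p])
  moreover have "Re ((mat_adjoint W * (M * W) *\<^sub>v v) \<bullet>c v) > 0"
    if v: "v \<in> carrier_vec p" "v \<noteq> 0\<^sub>v p" for v
  proof -
    have Wv: "W *\<^sub>v v \<in> carrier_vec N" using W v by auto
    have "(mat_adjoint W * (M * W)) *\<^sub>v v = mat_adjoint W *\<^sub>v (M *\<^sub>v (W *\<^sub>v v))"
      using W W' Mc v by (simp add: assoc_mult_mat_vec[of _ p N _ p] assoc_mult_mat_vec[of _ N N _ p])
    then have "(mat_adjoint W * (M * W) *\<^sub>v v) \<bullet>c v = (M *\<^sub>v (W *\<^sub>v v)) \<bullet>c (W *\<^sub>v v)"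
      using adjoint_cscalar_prod[OF W _ v(1), of "M *\<^sub>v (W *\<^sub>v v)"] Mc Wv by auto
    then show ?thesis using pos[OF Wv] inj v by auto
  qed
  moreover have "mat_adjoint W * (M * W) \<in> carrier_mat p p" using W W' Mc by auto
  ultimately show ?thesis by (auto simp: herm_pos_def_def)
qed

text \<open>
  The algebra of the weights. The matrix \<open>G\<close> is congruent to \<open>H\<^sup>-\<^sup>1\<close>, hence Hermitian, and it equals
  \<open>X Y\<^sup>-\<^sup>1\<close>. The weight \<open>P1_0\<close> has this form with \<open>X = E\<^sub>m\<close>, \<open>Y = D\<^sub>m\<close>, and \<open>Q2_0\<close> with \<open>X = D\<^sub>m\<close>,
  \<open>Y = E\<^sub>m\<^sub>+\<^sub>1\<close>.
\<close>

lemma pos_def_factor: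
  assumes H: "herm_pos_def q H" and X: "X \<in> carrier_mat q q" and Y: "Y \<in> carrier_mat q q"
    and XY: "mat_adjoint X * Y = H" and G: "G = X * minv H * mat_adjoint X"
  shows "G \<in> carrier_mat q q" "G * Y = X" "mat_adjoint Y * G = mat_adjoint X"
proof -
  have Hc: "H \<in> carrier_mat q q" using H by (auto simp: herm_pos_def_def)
  note I = minv_pos_def[OF H]
  have Xa: "mat_adjoint X \<in> carrier_mat q q" using X by auto
  have XI: "X * minv H \<in> carrier_mat q q" using X I(1) by auto
  show Gc: "G \<in> carrier_mat q q" using XI Xa G by auto
  have "G * Y = X * (minv H * (mat_adjoint X * Y))"
    using X Y I(1) Xa by (simp add: G assoc_mult_mat[of _ q q _ q _ q] mult_carrier_square)
  then show GY: "G * Y = X" using X I XY by simp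
  have "mat_adjoint G = G"
    using X I Xa XI
    by (simp add: G adjoint_mult[of _ q q _ q] assoc_mult_mat[of _ q q _ q _ q])
  then show "mat_adjoint Y * G = mat_adjoint X"
    using adjoint_mult[OF Gc Y] GY by simp
qed

section \<open>Finite sums of matrices\<close>

lemma mat_sum_cong:
  "(\<And>i. i < n \<Longrightarrow> f i = g i) \<Longrightarrow> mat_sum q f n = mat_sum q g n"
  by (induction n) auto

lemma mat_sum_add:
  assumes "\<And>i. i < n \<Longrightarrow> f i \<in> carrier_mat q q" "\<And>i. i < n \<Longrightarrow> g i \<in> carrier_mat q q"
  shows "mat_sum q (\<lambda>i. f i + g i) n = mat_sum q f n + mat_sum q g n"
  using assms
proof (induction n)
  case (Suc n)
  define a b where "a = mat_sum q f n" and "b = mat_sum q g n"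
  have c: "a \<in> carrier_mat q q" "b \<in> carrier_mat q q" "f n \<in> carrier_mat q q" "g n \<in> carrier_mat q q"
    unfolding a_def b_def using Suc.prems by (auto intro: mat_sum_carrier)
  have "a + b + (f n + g n) = a + f n + (b + g n)"
    using c by (intro eq_matI) auto
  then show ?case using Suc by (simp add: a_def b_def)
qed auto

lemma mat_sum_mult_right:
  assumes "\<And>i. i < n \<Longrightarrow> f i \<in> carrier_mat q q" "B \<in> carrier_mat q q"
  shows "mat_sum q (\<lambda>i. f i * B) n = mat_sum q f n * B"
  using assms(1)
proof (induction n)
  case (Suc n)
  then show ?case
    using assms(2) mat_sum_carrier[of n f q] by (simp add: add_mult_distrib_mat[of _ q q _ _ q])
qed (use assms in auto)

lemma mat_sum_smult:
  assumes "\<And>i. i < n \<Longrightarrow> f i \<in> carrier_mat q q"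
  shows "mat_sum q (\<lambda>i. c \<cdot>\<^sub>m f i) n = c \<cdot>\<^sub>m mat_sum q f n"
  using assms
proof (induction n)
  case (Suc n)
  then show ?case
    using mat_sum_carrier[of n f q] by (simp add: add_smult_distrib_left_mat[of _ q q])
qed auto

lemma mat_sum_adjoint:
  assumes "\<And>i. i < n \<Longrightarrow> f i \<in> carrier_mat q q"
  shows "mat_sum q (\<lambda>i. mat_adjoint (f i)) n = mat_adjoint (mat_sum q f n)"
  using assms
proof (induction n)
  case (Suc n)
  have "mat_sum q f n \<in> carrier_mat q q" "f n \<in> carrier_mat q q"
    using Suc.prems by (auto intro: mat_sum_carrier)
  then have "mat_adjoint (mat_sum q f n + f n) = mat_adjoint (mat_sum q f n) + mat_adjoint (f n)"
    by (intro eq_matI) auto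
  then show ?case using Suc by simp
qed auto

lemma mat_sum_Suc_shift:
  assumes "\<And>i. i \<le> n \<Longrightarrow> f i \<in> carrier_mat q q"
  shows "mat_sum q f (Suc n) = f 0 + mat_sum q (\<lambda>i. f (Suc i)) n"
  using assms
proof (induction n)
  case (Suc n)
  have "mat_sum q f (Suc (Suc n)) = f 0 + mat_sum q (\<lambda>i. f (Suc i)) n + f (Suc n)"
    using Suc by simp
  also have "\<dots> = f 0 + (mat_sum q (\<lambda>i. f (Suc i)) n + f (Suc n))"
    using Suc.prems by (intro assoc_add_mat[of _ q q] mat_sum_carrier) auto
  finally show ?case by simp
qed auto

lemma mat_sum_zero:
  "(\<And>i. i < n \<Longrightarrow> f i = 0\<^sub>m q q) \<Longrightarrow> mat_sum q f n = 0\<^sub>m q q"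
  by (induction n) auto

lemma mat_sum_single:
  assumes "k < n" "f k \<in> carrier_mat q q" "\<And>i. i < n \<Longrightarrow> i \<noteq> k \<Longrightarrow> f i = 0\<^sub>m q q"
  shows "mat_sum q f n = f k"
  using assms
proof (induction n)
  case (Suc n)
  show ?case
  proof (cases "k = n")
    case True
    then have "mat_sum q f n = 0\<^sub>m q q" using Suc.prems by (intro mat_sum_zero) auto
    then show ?thesis using True Suc.prems by simp
  next
    case False
    then show ?thesis using Suc by auto
  qed
qed auto

section \<open>Block matrices\<close>

lemma block_mat_dim [simp]:
  "dim_row (block_mat q r c F) = r * q" "dim_col (block_mat q r c F) = c * q"
  by (auto simp: block_mat_def)

lemma block_mat_carrier [simp]: "block_mat q r c F \<in> carrier_mat (r * q) (c * q)"
  by (auto simp: block_mat_def)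

lemma block_mat_index:
  "i < r * q \<Longrightarrow> k < c * q \<Longrightarrow>
     block_mat q r c F $$ (i, k) = F (i div q) (k div q) $$ (i mod q, k mod q)"
  by (auto simp: block_mat_def)

lemma block_index_bounds:
  fixes i r q :: nat
  assumes "i < r * q" shows "i div q < r" "i mod q < q"
  using assms by (cases q; simp add: less_mult_imp_div_less)+

lemma block_mat_cong:
  assumes "\<And>a b. a < r \<Longrightarrow> b < c \<Longrightarrow> F a b = G a b"
  shows "block_mat q r c F = block_mat q r c G"
  using assms by (intro eq_matI) (auto simp: block_mat_index block_index_bounds)

lemma block_mat_eq_block:
  assumes "block_mat q r c F = block_mat q r c G" "a < r" "b < c"
    and "F a b \<in> carrier_mat q q" "G a b \<in> carrier_mat q q"
  shows "F a b = G a b"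
proof (rule eq_matI)
  fix i k assume ik: "i < dim_row (G a b)" "k < dim_col (G a b)"
  then have ik': "i < q" "k < q" using assms by auto
  have lt: "x * q + l < n * q" if "x < n" "l < q" for x l n :: nat
    using that mult_le_mono1[of "Suc x" n q] by simp
  have "block_mat q r c H $$ (a * q + i, b * q + k) = H a b $$ (i, k)" for H
    using ik' lt assms(2,3) by (subst block_mat_index) auto
  then show "F a b $$ (i, k) = G a b $$ (i, k)" using assms(1) by metis
qed (use assms in auto)

lemma block_mat_single:
  "F 0 0 \<in> carrier_mat q q \<Longrightarrow> block_mat q 1 1 F = F 0 0"
  by (intro eq_matI) (auto simp: block_mat_index)

lemma block_mat_mult:
  assumes F: "\<And>a k. a < r \<Longrightarrow> k < c \<Longrightarrow> F a k \<in> carrier_mat q q"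
    and G: "\<And>k b. k < c \<Longrightarrow> b < d \<Longrightarrow> G k b \<in> carrier_mat q q"
  shows "block_mat q r c F * block_mat q c d G
    = block_mat q r d (\<lambda>a b. mat_sum q (\<lambda>k. F a k * G k b) c)" (is "?L = ?R")
proof (rule eq_matI)
  fix i j assume ij0: "i < dim_row ?R" "j < dim_col ?R"
  then have ij: "i < r * q" "j < d * q" by auto
  note ib = block_index_bounds[OF ij(1)] and jb = block_index_bounds[OF ij(2)]
  have "?L $$ (i, j) = (\<Sum>l<c * q. F (i div q) (l div q) $$ (i mod q, l mod q)
      * G (l div q) (j div q) $$ (l mod q, j mod q))"
    using ij by (auto simp: scalar_prod_def block_mat_index atLeast0LessThan intro!: sum.cong)
  also have "\<dots> = (\<Sum>k<c. \<Sum>p<q. F (i div q) k $$ (i mod q, p) * G k (j div q) $$ (p, j mod q))"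
  proof (induction c)
    case (Suc c)
    have "(\<Sum>l<Suc c * q. g l) = (\<Sum>l<c * q. g l) + (\<Sum>p<q. g (c * q + p))" for g :: "nat \<Rightarrow> complex"
      using sum.atLeastLessThan_concat[of 0 "c*q" "c*q+q" g] sum.shift_bounds_nat_ivl[of g 0 "c*q" q]
      by (simp add: atLeast0LessThan add.commute)
    then show ?case using Suc by simp
  qed simp
  also have "\<dots> = (\<Sum>k<c. (F (i div q) k * G k (j div q)) $$ (i mod q, j mod q))"
  proof (rule sum.cong)
    fix k assume "k \<in> {..<c}"
    then have "F (i div q) k \<in> carrier_mat q q" "G k (j div q) \<in> carrier_mat q q"
      using F[OF ib(1)] G[OF _ jb(1)] by auto
    then show "(\<Sum>p<q. F (i div q) k $$ (i mod q, p) * G k (j div q) $$ (p, j mod q))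
        = (F (i div q) k * G k (j div q)) $$ (i mod q, j mod q)"
      using ib jb by (auto simp: scalar_prod_def atLeast0LessThan intro!: sum.cong)
  qed simp
  also have "\<dots> = mat_sum q (\<lambda>k. F (i div q) k * G k (j div q)) c $$ (i mod q, j mod q)"
    using ib jb by (subst mat_sum_index) (auto intro: mult_carrier_mat[OF F G])
  also have "\<dots> = ?R $$ (i, j)"
    using ij by (simp add: block_mat_index)
  finally show "?L $$ (i, j) = ?R $$ (i, j)" .
qed auto

lemma block_mat_adjoint:
  assumes "\<And>a b. a < r \<Longrightarrow> b < c \<Longrightarrow> F a b \<in> carrier_mat q q"
  shows "mat_adjoint (block_mat q r c F) = block_mat q c r (\<lambda>a b. mat_adjoint (F b a))"
proof (rule eq_matI)
  fix i j assume "i < dim_row (block_mat q c r (\<lambda>a b. mat_adjoint (F b a)))"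
    "j < dim_col (block_mat q c r (\<lambda>a b. mat_adjoint (F b a)))"
  then have ij: "i < c * q" "j < r * q" by auto
  note ib = block_index_bounds[OF ij(1)] and jb = block_index_bounds[OF ij(2)]
  then show "mat_adjoint (block_mat q r c F) $$ (i, j)
      = block_mat q c r (\<lambda>a b. mat_adjoint (F b a)) $$ (i, j)"
    using ij assms[of "j div q" "i div q"] by (auto simp: block_mat_index)
qed auto

lemma block_mat_uminus:
  assumes "\<And>a b. a < r \<Longrightarrow> b < c \<Longrightarrow> F a b \<in> carrier_mat q q"
  shows "- block_mat q r c F = block_mat q r c (\<lambda>a b. - F a b)"
proof (rule eq_matI)
  fix i j assume "i < dim_row (block_mat q r c (\<lambda>a b. - F a b))"
    "j < dim_col (block_mat q r c (\<lambda>a b. - F a b))"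
  then have ij: "i < r * q" "j < c * q" by auto
  note ib = block_index_bounds[OF ij(1)] and jb = block_index_bounds[OF ij(2)]
  then show "(- block_mat q r c F) $$ (i, j) = block_mat q r c (\<lambda>a b. - F a b) $$ (i, j)"
    using ij assms[of "i div q" "j div q"] by (auto simp: block_mat_index)
qed auto

section \<open>Monic polynomials orthogonal with respect to a block Hankel matrix\<close>

lemma append_cols_block_row:
  assumes "\<And>b. b < j \<Longrightarrow> F b \<in> carrier_mat q q" "G \<in> carrier_mat q q"
  shows "append_cols (block_mat q 1 j (\<lambda>a. F)) G = block_mat q 1 (j + 1) (\<lambda>a b. if b < j then F b else G)"
proof (rule eq_matI)
  fix i k assume "i < dim_row (block_mat q 1 (j + 1) (\<lambda>a b. if b < j then F b else G))"
    "k < dim_col (block_mat q 1 (j + 1) (\<lambda>a b. if b < j then F b else G))"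
  then have ik: "i < q" "k < (j + 1) * q" by auto
  show "append_cols (block_mat q 1 j (\<lambda>a. F)) G $$ (i, k)
      = block_mat q 1 (j + 1) (\<lambda>a b. if b < j then F b else G) $$ (i, k)"
  proof (cases "k < j * q")
    case True
    then show ?thesis using ik assms(2) block_index_bounds[OF True]
      by (auto simp: append_cols_def block_mat_index)
  next
    case False
    define l where "l = k - j * q"
    have "k = j * q + l" "l < q" using False ik by (auto simp: l_def)
    then show ?thesis using ik assms(2) False
      by (auto simp: append_cols_def block_mat_index)
  qed
qed (use assms in \<open>auto simp: append_cols_def\<close>)

lemma vmat_block: "vmat q j = block_mat q (j + 1) 1 (\<lambda>a b. if a = 0 then 1\<^sub>m q else 0\<^sub>m q q)"
proof (cases "j = 0")
  case True
  then show ?thesis using block_mat_single[of "\<lambda>a b. if a = 0 then 1\<^sub>m q else 0\<^sub>m q q" q]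
    by (simp add: vmat_def)
next
  case False
  show ?thesis
  proof (rule eq_matI)
    fix i k assume "i < dim_row (block_mat q (j + 1) 1 (\<lambda>a b. if a = 0 then 1\<^sub>m q else 0\<^sub>m q q))"
      "k < dim_col (block_mat q (j + 1) 1 (\<lambda>a b. if a = 0 then 1\<^sub>m q else 0\<^sub>m q q))"
    then have ik: "i < (j + 1) * q" "k < q" by auto
    have "i div q = 0 \<longleftrightarrow> i < q" using ik by (auto simp: div_eq_0_iff)
    then show "vmat q j $$ (i, k)
        = block_mat q (j + 1) 1 (\<lambda>a b. if a = 0 then 1\<^sub>m q else 0\<^sub>m q q) $$ (i, k)"
      using ik False block_index_bounds[OF ik(1)]
      by (auto simp: vmat_def append_rows_def block_mat_index)
  qed (use False in \<open>auto simp: vmat_def append_rows_def\<close>)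
qed

lemma Rmat_0: "j \<ge> 1 \<Longrightarrow> Rmat q j 0 = 1\<^sub>m ((j + 1) * q)"
proof -
  assume "j \<ge> 1"
  then have "Tmat q j \<in> carrier_mat ((j + 1) * q) ((j + 1) * q)"
    by (auto simp: Tmat_def add.commute)
  then have "1\<^sub>m ((j + 1) * q) - 0 \<cdot>\<^sub>m Tmat q j = 1\<^sub>m ((j + 1) * q)"
    by (intro eq_matI) auto
  then show ?thesis
    unfolding Rmat_def by (simp only:) (rule minv_eqI, auto)
qed

text \<open>
  \<open>x 0, \<dots>, x j\<close> are the ascending coefficients of a monic polynomial of degree \<open>j\<close> that is
  orthogonal to all lower powers for the matrix moments \<open>t\<close>: the block column of its coefficients is
  annihilated by all but the last block row of the Hankel matrix of \<open>t\<close>.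
\<close>

definition monic_orthogonal ::
    "nat \<Rightarrow> (nat \<Rightarrow> complex mat) \<Rightarrow> nat \<Rightarrow> (nat \<Rightarrow> complex mat) \<Rightarrow> bool" where
  "monic_orthogonal q t j x \<longleftrightarrow>
     (\<forall>i\<le>j. x i \<in> carrier_mat q q) \<and> x j = 1\<^sub>m q \<and>
     (\<forall>k<j. mat_sum q (\<lambda>i. t (i + k) * x i) (Suc j) = 0\<^sub>m q q)"

context
  fixes q j :: nat and t :: "nat \<Rightarrow> complex mat"
  assumes t: "\<And>i. t i \<in> carrier_mat q q"
begin

lemma H1_herm_entries:
  assumes "herm_pos_def ((j + 1) * q) (H1 q t j)" "i \<le> 2 * j"
  shows "mat_adjoint (t i) = t i"
proof -
  \<comment> \<open>Every index up to \<open>2j\<close> is a sum of two block indices of \<open>H1 q t j\<close>.\<close>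
  define a where "a = min i j"
  define b where "b = i - a"
  have ab: "a < j + 1" "b < j + 1" "i = a + b" using assms(2) by (auto simp: a_def b_def)
  have "block_mat q (j + 1) (j + 1) (\<lambda>a b. mat_adjoint (t (b + a)))
      = block_mat q (j + 1) (j + 1) (\<lambda>a b. t (a + b))"
    using assms(1) t block_mat_adjoint[of "j + 1" "j + 1" "\<lambda>a b. t (a + b)" q]
    by (simp add: herm_pos_def_def H1_def)
  from block_mat_eq_block[OF this ab(1,2)] show ?thesis
    using t ab(3) by (auto simp: add.commute)
qed

lemma adjoint_Y1: "j \<ge> 1 \<Longrightarrow> mat_adjoint (Y1 q t j) = block_mat q 1 j (\<lambda>a b. t (j + b))"
  by (cases j) (auto simp: Y1_def y_seg_def)

lemma Y1_block:
  assumes "j \<ge> 1"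
  shows "Y1 q t j = block_mat q j 1 (\<lambda>a b. mat_adjoint (t (j + a)))"
proof -
  have "Y1 q t j = mat_adjoint (mat_adjoint (Y1 q t j))" by simp
  also have "\<dots> = block_mat q j 1 (\<lambda>a b. mat_adjoint (t (j + a)))"
    unfolding adjoint_Y1[OF assms] using t by (subst block_mat_adjoint) auto
  finally show ?thesis .
qed

text \<open>
  Moving the terms of the leading coefficient \<open>I\<close> to the right leaves a square system for the lower
  coefficients, with the Hankel matrix of the next smaller order.
\<close>

lemma monic_orthogonal_Hankel_system:
  assumes x: "monic_orthogonal q t j x" and "j \<ge> 1"
    and pd: "herm_pos_def (j * q) (H1 q t (j - 1))"
  shows "block_mat q j 1 (\<lambda>a b. x a)
    = - (minv (H1 q t (j - 1)) * block_mat q j 1 (\<lambda>a b. t (j + a)))"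
proof -
  define X where "X = block_mat q j 1 (\<lambda>a b. x a)"
  define Y where "Y = block_mat q j 1 (\<lambda>a b. t (j + a))"
  define H where "H = H1 q t (j - 1)"
  have xc: "x i \<in> carrier_mat q q" if "i \<le> j" for i
    using x that by (auto simp: monic_orthogonal_def)
  have H: "H \<in> carrier_mat (j * q) (j * q)" "H = block_mat q j j (\<lambda>a b. t (a + b))"
    using \<open>j \<ge> 1\<close> pd by (auto simp: H_def H1_def herm_pos_def_def)
  have XY: "X \<in> carrier_mat (j * q) q" "Y \<in> carrier_mat (j * q) q"
    using block_mat_carrier[of q j 1] by (auto simp: X_def Y_def)
  have inv: "minv H \<in> carrier_mat (j * q) (j * q)" "minv H * H = 1\<^sub>m (j * q)"
    using minv_pos_def[OF pd] by (auto simp: H_def)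
  have "H * X = block_mat q j 1 (\<lambda>a b. mat_sum q (\<lambda>i. t (a + i) * x i) j)"
    unfolding H X_def using t xc by (subst block_mat_mult) auto
  also have "\<dots> = block_mat q j 1 (\<lambda>a b. - t (j + a))"
  proof (rule block_mat_cong)
    fix a b :: nat assume a: "a < j"
    have "mat_sum q (\<lambda>i. t (a + i) * x i) j + t (j + a) = 0\<^sub>m q q"
      using x a t[of "j + a"] by (auto simp: monic_orthogonal_def add.commute)
    then show "mat_sum q (\<lambda>i. t (a + i) * x i) j = - t (j + a)"
      using t xc by (intro add_eq_zero_mat[of _ _ q q] mat_sum_carrier) auto
  qed
  also have "\<dots> = - Y" unfolding Y_def using t by (subst block_mat_uminus) auto
  finally have HX: "H * X = - Y" .
  have "X = (minv H * H) * X" using inv XY by simp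
  also have "\<dots> = minv H * (H * X)"
    using inv XY H by (intro assoc_mult_mat[of _ "j * q" "j * q" _ "j * q" _ q]) auto
  also have "\<dots> = - (minv H * Y)" using HX inv XY by simp
  finally show ?thesis by (simp add: X_def Y_def H_def)
qed

lemma monic_orthogonal_unique:
  assumes "monic_orthogonal q t j x" "monic_orthogonal q t j x'"
    and "j \<ge> 1 \<Longrightarrow> herm_pos_def (j * q) (H1 q t (j - 1))" and "i \<le> j"
  shows "x i = x' i"
proof (cases "i = j")
  case False
  then have j: "j \<ge> 1" and i: "i < j" using assms(4) by auto
  have "block_mat q j 1 (\<lambda>a b. x a) = block_mat q j 1 (\<lambda>a b. x' a)"
    using monic_orthogonal_Hankel_system[OF assms(1) j assms(3)[OF j]]
      monic_orthogonal_Hankel_system[OF assms(2) j assms(3)[OF j]] by metis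
  from block_mat_eq_block[OF this i, of 0] show ?thesis
    using assms(1,2,4) by (auto simp: monic_orthogonal_def)
qed (use assms in \<open>auto simp: monic_orthogonal_def\<close>)

context
  fixes x :: "nat \<Rightarrow> complex mat"
  assumes x: "monic_orthogonal q t j x"
    and pd: "herm_pos_def ((j + 1) * q) (H1 q t j)"
    and pd': "j \<ge> 1 \<Longrightarrow> herm_pos_def (j * q) (H1 q t (j - 1))"
begin

lemma monic_orthogonal_carrier: "i \<le> j \<Longrightarrow> x i \<in> carrier_mat q q" and monic_orthogonal_monic: "x j = 1\<^sub>m q"
  using x by (auto simp: monic_orthogonal_def)

text \<open>
  Solving the Hankel system for the lower coefficients turns the correction
  \<open>-Y\<^sup>* H\<^sup>-\<^sup>1 Y\<close> of the Schur complement into their share of the last block row.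
\<close>

lemma H1hat_eq_last_moment: "H1hat q t j = mat_sum q (\<lambda>i. t (i + j) * x i) (Suc j)"
proof (cases "j = 0")
  case True
  then show ?thesis using x t[of 0] by (auto simp: H1hat_def monic_orthogonal_def)
next
  case False
  then have j: "j \<ge> 1" by simp
  define X where "X = block_mat q j 1 (\<lambda>a b. x a)"
  define Z where "Z = mat_adjoint (Y1 q t j)"
  define I where "I = minv (H1 q t (j - 1))"
  have Y: "Y1 q t j = block_mat q j 1 (\<lambda>a b. t (j + a))"
    unfolding Y1_block[OF j] by (rule block_mat_cong) (use H1_herm_entries[OF pd] in auto)
  have Yc: "Y1 q t j \<in> carrier_mat (j * q) q" "Z \<in> carrier_mat q (j * q)"
    using block_mat_carrier[of q j 1] block_mat_carrier[of q 1 j]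
    unfolding Y Z_def adjoint_Y1[OF j] by auto
  have Ic: "I \<in> carrier_mat (j * q) (j * q)" using minv_pos_def[OF pd'[OF j]] by (simp add: I_def)
  have S: "mat_sum q (\<lambda>i. t (j + i) * x i) j \<in> carrier_mat q q"
    using t monic_orthogonal_carrier by (intro mat_sum_carrier) auto
  have "X = - (I * Y1 q t j)"
    using monic_orthogonal_Hankel_system[OF x j pd'[OF j]] by (simp add: X_def I_def Y)
  then have "Z * X = - (Z * I * Y1 q t j)"
    using Yc Ic by (simp add: assoc_mult_mat[of _ q "j * q" _ "j * q" _ q])
  moreover have "Z * X = block_mat q 1 1 (\<lambda>a b. mat_sum q (\<lambda>i. t (j + i) * x i) j)"
    unfolding Z_def adjoint_Y1[OF j] X_def using t monic_orthogonal_carrier by (subst block_mat_mult) auto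
  moreover have "\<dots> = mat_sum q (\<lambda>i. t (j + i) * x i) j"
    by (rule block_mat_single) (rule S)
  ultimately have ZX: "mat_sum q (\<lambda>i. t (j + i) * x i) j = - (Z * I * Y1 q t j)" by simp
  have "Z * I * Y1 q t j \<in> carrier_mat q q"
    using Yc Ic by (intro mult_carrier_mat[of _ q "j * q"]) auto
  then have "t (2 * j) - Z * I * Y1 q t j = t (2 * j) + mat_sum q (\<lambda>i. t (j + i) * x i) j"
    unfolding ZX using t[of "2 * j"] by (intro eq_matI) auto
  then have "H1hat q t j = t (2 * j) + mat_sum q (\<lambda>i. t (j + i) * x i) j"
    using False by (simp add: H1hat_def Z_def I_def)
  also have "\<dots> = mat_sum q (\<lambda>i. t (i + j) * x i) (Suc j)"
    using t[of "j + j"] S monic_orthogonal_monic by (simp add: add.commute mult_2 comm_add_mat[of _ q q])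
  finally show ?thesis .
qed

text \<open>
  Let \<open>W\<close> be the block column of the coefficients. By orthogonality only the last block of \<open>H1 W\<close>
  survives, and it is the Schur complement. As the last block of \<open>W\<close> is \<open>I\<close>, the Schur complement is
  \<open>W\<^sup>* H1 W\<close>, and \<open>W\<close> is injective.
\<close>

lemma H1hat_pos_def: "herm_pos_def q (H1hat q t j)"
proof -
  define S where "S = H1hat q t j"
  define W where "W = block_mat q (j + 1) 1 (\<lambda>a b. x a)"
  have Sc: "S \<in> carrier_mat q q"
    unfolding S_def H1hat_eq_last_moment using t monic_orthogonal_carrier by (intro mat_sum_carrier) auto
  have W: "W \<in> carrier_mat ((j + 1) * q) q" using block_mat_carrier[of q "j + 1" 1] by (simp add: W_def)
  have "H1 q t j * W = block_mat q (j + 1) 1 (\<lambda>a b. mat_sum q (\<lambda>i. t (a + i) * x i) (j + 1))"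
    unfolding H1_def W_def using t monic_orthogonal_carrier by (subst block_mat_mult) auto
  also have "\<dots> = block_mat q (j + 1) 1 (\<lambda>a b. if a = j then S else 0\<^sub>m q q)"
  proof (rule block_mat_cong)
    fix a b assume "a < j + 1"
    then show "mat_sum q (\<lambda>i. t (a + i) * x i) (j + 1) = (if a = j then S else 0\<^sub>m q q)"
      using x H1hat_eq_last_moment
      by (auto simp: S_def monic_orthogonal_def add.commute[of a] simp del: mat_sum.simps)
  qed
  finally have HW: "H1 q t j * W = block_mat q (j + 1) 1 (\<lambda>a b. if a = j then S else 0\<^sub>m q q)" .
  have "mat_adjoint W * (H1 q t j * W) = block_mat q 1 1 (\<lambda>a b.
      mat_sum q (\<lambda>i. mat_adjoint (x i) * (if i = j then S else 0\<^sub>m q q)) (j + 1))"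
    unfolding HW unfolding W_def using monic_orthogonal_carrier Sc
    by (subst block_mat_adjoint) (auto simp: block_mat_mult adjoint_carrier simp del: mat_sum.simps)
  also have "\<dots> = block_mat q 1 1 (\<lambda>a b. S)"
  proof (rule block_mat_cong)
    fix a b :: nat
    have "mat_sum q (\<lambda>i. mat_adjoint (x i) * (if i = j then S else 0\<^sub>m q q)) (j + 1)
        = mat_adjoint (x j) * (if j = j then S else 0\<^sub>m q q)"
      using monic_orthogonal_carrier Sc adjoint_carrier[OF monic_orthogonal_carrier]
      by (intro mat_sum_single) (auto simp: right_mult_zero_mat[of _ q q])
    then show "mat_sum q (\<lambda>i. mat_adjoint (x i) * (if i = j then S else 0\<^sub>m q q)) (j + 1) = S"
      using Sc monic_orthogonal_monic by simp
  qed
  also have "\<dots> = S" using Sc block_mat_single by auto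
  finally have WHW: "mat_adjoint W * (H1 q t j * W) = S" .
  have "herm_pos_def q (mat_adjoint W * (H1 q t j * W))"
  proof (rule herm_pos_def_congruence[OF pd W])
    fix v assume v: "v \<in> carrier_vec q" "W *\<^sub>v v = 0\<^sub>v ((j + 1) * q)"
    show "v = 0\<^sub>v q"
    proof (rule eq_vecI)
      fix i assume "i < dim_vec (0\<^sub>v q :: complex vec)"
      then have i: "i < q" by simp
      have r: "row W (j * q + i) = row (1\<^sub>m q) i"
        using i monic_orthogonal_monic W unfolding W_def
        by (intro eq_vecI) (auto simp: block_mat_index)
      have "(W *\<^sub>v v) $ (j * q + i) = row (1\<^sub>m q) i \<bullet> v"
        using W i by (simp add: r)
      also have "\<dots> = v $ i" using v i by simp
      finally show "v $ i = 0\<^sub>v q $ i" using v i by simp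
    qed (use v in auto)
  qed
  then show ?thesis using WHW by (simp add: S_def)
qed

text \<open>
  The block row in the definitions of \<open>P1\<close> and \<open>Q2\<close> consists of the adjoint coefficients of the
  orthogonal polynomial: \<open>-Y\<^sup>* H\<^sup>-\<^sup>1\<close> is the adjoint of the solution \<open>-H\<^sup>-\<^sup>1 Y\<close> of the Hankel system.
\<close>

lemma orthogonal_block_row:
  assumes j: "j \<ge> 1"
  shows "append_cols (- (mat_adjoint (Y1 q t j) * minv (H1 q t (j - 1)))) (1\<^sub>m q)
    = block_mat q 1 (j + 1) (\<lambda>a b. mat_adjoint (x b))"
proof -
  define X where "X = block_mat q j 1 (\<lambda>a b. x a)"
  define I where "I = minv (H1 q t (j - 1))"
  have Y: "Y1 q t j = block_mat q j 1 (\<lambda>a b. t (j + a))"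
    unfolding Y1_block[OF j] by (rule block_mat_cong) (use H1_herm_entries[OF pd] in auto)
  have Yc: "Y1 q t j \<in> carrier_mat (j * q) q"
    using block_mat_carrier[of q j 1] unfolding Y by auto
  have I: "I \<in> carrier_mat (j * q) (j * q)" "mat_adjoint I = I"
    using minv_pos_def[OF pd'[OF j]] by (auto simp: I_def)
  have X: "X = - (I * Y1 q t j)"
    using monic_orthogonal_Hankel_system[OF x j pd'[OF j]] by (simp add: X_def I_def Y)
  have "- (mat_adjoint (Y1 q t j) * I) = mat_adjoint X"
    unfolding X using adjoint_mult[OF I(1) Yc] I by (simp add: adjoint_uminus)
  also have "\<dots> = block_mat q 1 j (\<lambda>a b. mat_adjoint (x b))"
    unfolding X_def using monic_orthogonal_carrier by (subst block_mat_adjoint) auto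
  finally have "append_cols (- (mat_adjoint (Y1 q t j) * I)) (1\<^sub>m q)
    = block_mat q 1 (j + 1) (\<lambda>a b. if b < j then mat_adjoint (x b) else 1\<^sub>m q)"
    using monic_orthogonal_carrier by (simp only:) (rule append_cols_block_row, auto intro: adjoint_carrier)
  also have "\<dots> = block_mat q 1 (j + 1) (\<lambda>a b. mat_adjoint (x b))"
    by (rule block_mat_cong) (use monic_orthogonal_monic in \<open>auto simp: less_Suc_eq\<close>)
  finally show ?thesis by (simp add: I_def)
qed

text \<open>
  At the point \<open>0\<close> the resolvent \<open>Rmat\<close> is the identity, and \<open>vmat\<close> selects the first block.
\<close>

lemma P1_at_0: "P1 q t j 0 = mat_adjoint (x 0)"
proof (cases "j = 0")
  case True
  then show ?thesis using monic_orthogonal_monic by (simp add: P1_def)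
next
  case False
  then have j: "j \<ge> 1" by simp
  have xa: "mat_adjoint (x i) \<in> carrier_mat q q" if "i \<le> j" for i
    using monic_orthogonal_carrier[OF that] by auto
  have "P1 q t j 0 = append_cols (- (mat_adjoint (Y1 q t j) * minv (H1 q t (j - 1)))) (1\<^sub>m q)
      * Rmat q j 0 * vmat q j"
    using False by (simp add: P1_def)
  also have "\<dots> = block_mat q 1 (j + 1) (\<lambda>a b. mat_adjoint (x b)) * vmat q j"
    unfolding orthogonal_block_row[OF j] Rmat_0[OF j] right_mult_one_mat[OF block_mat_carrier] ..
  also have "\<dots> = block_mat q 1 1 (\<lambda>a b.
      mat_sum q (\<lambda>k. mat_adjoint (x k) * (if k = 0 then 1\<^sub>m q else 0\<^sub>m q q)) (j + 1))"
    unfolding vmat_block using xa by (subst block_mat_mult) auto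
  also have "\<dots> = block_mat q 1 1 (\<lambda>a b. mat_adjoint (x 0))"
  proof (rule block_mat_cong)
    fix a b :: nat
    have "mat_sum q (\<lambda>k. mat_adjoint (x k) * (if k = 0 then 1\<^sub>m q else 0\<^sub>m q q)) (j + 1)
        = mat_adjoint (x 0) * (if 0 = (0::nat) then 1\<^sub>m q else 0\<^sub>m q q)"
      using xa by (intro mat_sum_single) (auto simp: right_mult_zero_mat[of _ q q])
    then show "mat_sum q (\<lambda>k. mat_adjoint (x k) * (if k = 0 then 1\<^sub>m q else 0\<^sub>m q q)) (j + 1)
        = mat_adjoint (x 0)"
      using xa[of 0] by (simp add: right_mult_one_mat[of _ q q] del: mat_sum.simps)
  qed
  also have "\<dots> = mat_adjoint (x 0)" using xa[of 0] block_mat_single by auto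
  finally show ?thesis .
qed

end

end

text \<open>
  The objects of the second kind are those of the first kind for the shifted sequence
  \<open>s 1, s 2, \<dots>\<close>, which reduces both Schur complements to one argument.
\<close>

lemma H2_eq_H1_shift: "H2 q s j = H1 q (\<lambda>i. s (Suc i)) j"
  by (simp add: H1_def H2_def)

lemma Y2_eq_Y1_shift: "j \<ge> 1 \<Longrightarrow> Y2 q s j = Y1 q (\<lambda>i. s (Suc i)) j"
  by (auto simp: Y1_def Y2_def y_seg_def intro!: arg_cong[where f = mat_adjoint])

lemma H2hat_eq_H1hat_shift: "H2hat q s j = H1hat q (\<lambda>i. s (Suc i)) j"
  by (cases "j = 0") (simp_all add: H1hat_def H2hat_def H2_eq_H1_shift Y2_eq_Y1_shift)

text \<open>
  Unlike \<open>vmat\<close>, the block column \<open>u2\<close> does not select a block: it pairs the coefficient \<open>x i\<close> with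
  \<open>s i\<close>, so that the value at \<open>0\<close> is a moment of \<open>x\<close> of order \<open>-1\<close> for the shifted sequence.
\<close>

lemma Q2_at_0:
  assumes s: "\<And>i. s i \<in> carrier_mat q q"
    and herm: "mat_adjoint (s 0) = s 0"
    and x: "monic_orthogonal q (\<lambda>i. s (Suc i)) j x"
    and pd: "herm_pos_def ((j + 1) * q) (H2 q s j)"
    and pd': "j \<ge> 1 \<Longrightarrow> herm_pos_def (j * q) (H2 q s (j - 1))"
  shows "Q2 q s j 0 = mat_adjoint (mat_sum q (\<lambda>i. s i * x i) (Suc j))"
proof (cases "j = 0")
  case True
  then show ?thesis using x s[of 0] herm by (auto simp: Q2_def monic_orthogonal_def)
next
  case False
  then have j: "j \<ge> 1" by simp
  have xc: "x i \<in> carrier_mat q q" if "i \<le> j" for i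
    using x that by (auto simp: monic_orthogonal_def)
  have sc: "mat_adjoint (s i) \<in> carrier_mat q q" for i using s[of i] by auto
  have u: "u2 q s j = - block_mat q (j + 1) 1 (\<lambda>a b. mat_adjoint (s a))"
    unfolding u2_def y_seg_def using s by (subst block_mat_adjoint) auto
  have row: "append_cols (- (mat_adjoint (Y2 q s j) * minv (H2 q s (j - 1)))) (1\<^sub>m q)
      = block_mat q 1 (j + 1) (\<lambda>a b. mat_adjoint (x b))"
    using orthogonal_block_row[of "\<lambda>i. s (Suc i)" q j x] s x pd pd' j
    by (simp add: H2_eq_H1_shift Y2_eq_Y1_shift)
  have "Q2 q s j 0 = - (append_cols (- (mat_adjoint (Y2 q s j) * minv (H2 q s (j - 1)))) (1\<^sub>m q)
      * Rmat q j 0 * u2 q s j)"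
    using False by (simp add: Q2_def)
  also have "\<dots> = - (- (block_mat q 1 (j + 1) (\<lambda>a b. mat_adjoint (x b))
      * block_mat q (j + 1) 1 (\<lambda>a b. mat_adjoint (s a))))"
    unfolding row Rmat_0[OF j] u right_mult_one_mat[OF block_mat_carrier]
    by (rule arg_cong[where f = uminus]) simp
  also have "\<dots> = block_mat q 1 (j + 1) (\<lambda>a b. mat_adjoint (x b))
      * block_mat q (j + 1) 1 (\<lambda>a b. mat_adjoint (s a))"
    by (rule eq_matI) auto
  also have "\<dots> = block_mat q 1 1 (\<lambda>a b. mat_sum q (\<lambda>k. mat_adjoint (x k) * mat_adjoint (s k)) (j + 1))"
    using xc sc by (subst block_mat_mult) auto
  also have "\<dots> = block_mat q 1 1 (\<lambda>a b. mat_sum q (\<lambda>k. mat_adjoint (s k * x k)) (j + 1))"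
    by (intro block_mat_cong mat_sum_cong) (use xc s in \<open>auto simp: adjoint_mult[of _ q q _ q]\<close>)
  also have "\<dots> = block_mat q 1 1 (\<lambda>a b. mat_adjoint (mat_sum q (\<lambda>k. s k * x k) (j + 1)))"
    using xc s by (subst mat_sum_adjoint) auto
  also have "\<dots> = mat_adjoint (mat_sum q (\<lambda>k. s k * x k) (j + 1))"
  proof -
    have "mat_sum q (\<lambda>k. s k * x k) (j + 1) \<in> carrier_mat q q"
      using xc s by (intro mat_sum_carrier) auto
    then show ?thesis by (intro block_mat_single) auto
  qed
  finally show ?thesis by simp
qed

section \<open>Laurent coefficients of the moment series times a matrix polynomial\<close>

text \<open>
  The coefficient of \<open>z\<^sup>-\<^sup>k\<^sup>-\<^sup>1\<close> in the moment series \<open>S(z)\<close>. Allowing all integers \<open>k\<close> lets one formula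
  describe the remainder and the polynomial part of a product.
\<close>

definition signed_moment :: "nat \<Rightarrow> (nat \<Rightarrow> complex mat) \<Rightarrow> int \<Rightarrow> complex mat" where
  "signed_moment q s k = (if k < 0 then 0\<^sub>m q q else (- 1) ^ nat k \<cdot>\<^sub>m s (nat k))"

text \<open>
  The coefficient of \<open>z\<^sup>-\<^sup>k\<^sup>-\<^sup>1\<close> in \<open>S(z) (p\<^sub>0 + \<dots> + p\<^sub>m z\<^sup>m)\<close>, or equivalently of \<open>z\<^sup>-\<^sup>k\<close> in \<open>z\<close> times
  this product. Negative \<open>k\<close> gives the polynomial part.
\<close>

definition laurent_coeff ::
    "nat \<Rightarrow> (nat \<Rightarrow> complex mat) \<Rightarrow> nat \<Rightarrow> (nat \<Rightarrow> complex mat) \<Rightarrow> int \<Rightarrow> complex mat" where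
  "laurent_coeff q s m p k = mat_sum q (\<lambda>i. signed_moment q s (int i + k) * p i) (Suc m)"

context
  fixes q :: nat and s :: "nat \<Rightarrow> complex mat"
  assumes s: "\<And>i. s i \<in> carrier_mat q q"
begin

lemma signed_moment_carrier [simp, intro]: "signed_moment q s k \<in> carrier_mat q q"
  using s by (auto simp: signed_moment_def)

lemma laurent_coeff_carrier:
  "(\<And>i. i \<le> m \<Longrightarrow> p i \<in> carrier_mat q q) \<Longrightarrow> laurent_coeff q s m p k \<in> carrier_mat q q"
  unfolding laurent_coeff_def by (intro mat_sum_carrier) auto

lemma laurent_coeff_cong:
  "(\<And>i. i \<le> m \<Longrightarrow> p i = p' i) \<Longrightarrow> laurent_coeff q s m p k = laurent_coeff q s m p' k"
  unfolding laurent_coeff_def by (intro mat_sum_cong) auto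

lemma laurent_coeff_mult_right:
  assumes "\<And>i. i \<le> m \<Longrightarrow> p i \<in> carrier_mat q q" "B \<in> carrier_mat q q"
  shows "laurent_coeff q s m (\<lambda>i. p i * B) k = laurent_coeff q s m p k * B"
proof -
  have "laurent_coeff q s m (\<lambda>i. p i * B) k
      = mat_sum q (\<lambda>i. (signed_moment q s (int i + k) * p i) * B) (Suc m)"
    unfolding laurent_coeff_def
    by (intro mat_sum_cong) (use assms in \<open>simp add: assoc_mult_mat[of _ q q _ q _ q]\<close>)
  also have "\<dots> = laurent_coeff q s m p k * B"
    unfolding laurent_coeff_def using assms by (intro mat_sum_mult_right) auto
  finally show ?thesis .
qed

lemma laurent_coeff_add:
  assumes "\<And>i. i \<le> m \<Longrightarrow> p i \<in> carrier_mat q q" "\<And>i. i \<le> m \<Longrightarrow> p' i \<in> carrier_mat q q"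
  shows "laurent_coeff q s m (\<lambda>i. p i + p' i) k = laurent_coeff q s m p k + laurent_coeff q s m p' k"
proof -
  have "laurent_coeff q s m (\<lambda>i. p i + p' i) k
      = mat_sum q (\<lambda>i. signed_moment q s (int i + k) * p i + signed_moment q s (int i + k) * p' i) (Suc m)"
    unfolding laurent_coeff_def
    by (intro mat_sum_cong) (use assms in \<open>simp add: mult_add_distrib_mat[of _ q q _ q]\<close>)
  also have "\<dots> = laurent_coeff q s m p k + laurent_coeff q s m p' k"
    unfolding laurent_coeff_def using assms by (intro mat_sum_add) auto
  finally show ?thesis .
qed

lemma laurent_coeff_extend:
  assumes "\<And>i. i \<le> m \<Longrightarrow> p i \<in> carrier_mat q q" "p (Suc m) = 0\<^sub>m q q"
  shows "laurent_coeff q s (Suc m) p k = laurent_coeff q s m p k"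
proof -
  have "signed_moment q s (int (Suc m) + k) * p (Suc m) = 0\<^sub>m q q"
    using assms(2) right_mult_zero_mat[OF signed_moment_carrier] by simp
  then show ?thesis
    using laurent_coeff_carrier[of m p k] assms(1)
    by (simp add: laurent_coeff_def right_add_zero_mat[of _ q q])
qed

lemma laurent_coeff_Suc:
  assumes "\<And>i. i \<le> Suc m \<Longrightarrow> p i \<in> carrier_mat q q"
  shows "laurent_coeff q s (Suc m) p k
    = signed_moment q s k * p 0 + laurent_coeff q s m (\<lambda>i. p (Suc i)) (k + 1)"
  unfolding laurent_coeff_def
  using assms by (subst mat_sum_Suc_shift) (auto simp: ac_simps)

text \<open>
  The signs \<open>(-1)\<^sup>j\<close> of the moment series disappear if \<open>z\<close> is replaced by \<open>-z\<close>; the coefficients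
  \<open>(-1)\<^sup>m\<^sup>-\<^sup>i p\<^sub>i\<close> are those of \<open>(-1)\<^sup>m p(-z)\<close>, which is monic if \<open>p\<close> is.
\<close>

lemma moment_eq_laurent_coeff:
  assumes p: "\<And>i. i \<le> m \<Longrightarrow> p i \<in> carrier_mat q q"
  shows "mat_sum q (\<lambda>i. s (i + k) * ((- 1) ^ (m - i) \<cdot>\<^sub>m p i)) (Suc m)
    = (- 1) ^ (m + k) \<cdot>\<^sub>m laurent_coeff q s m p (int k)"
proof -
  have "mat_sum q (\<lambda>i. s (i + k) * ((- 1) ^ (m - i) \<cdot>\<^sub>m p i)) (Suc m)
      = mat_sum q (\<lambda>i. (- 1) ^ (m + k) \<cdot>\<^sub>m (signed_moment q s (int i + int k) * p i)) (Suc m)"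
  proof (rule mat_sum_cong)
    fix i assume "i < Suc m"
    then have i: "i \<le> m" by simp
    have "signed_moment q s (int i + int k) = (- 1) ^ (i + k) \<cdot>\<^sub>m s (i + k)"
      by (simp add: signed_moment_def nat_add_distrib)
    moreover have "(- 1) ^ (m + k) * (- 1) ^ (i + k) = ((- 1) ^ (m - i) :: complex)"
      using i by (auto simp: minus_one_power_iff simp flip: power_add)
    ultimately show "s (i + k) * ((- 1) ^ (m - i) \<cdot>\<^sub>m p i)
        = (- 1) ^ (m + k) \<cdot>\<^sub>m (signed_moment q s (int i + int k) * p i)"
      using s[of "i + k"] p[OF i]
      by (simp add: mult_smult_distrib[of _ q q _ q] mult_smult_assoc_mat[of _ q q _ q] smult_smult_mat)
  qed
  also have "\<dots> = (- 1) ^ (m + k) \<cdot>\<^sub>m laurent_coeff q s m p (int k)"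
    unfolding laurent_coeff_def using p by (intro mat_sum_smult) auto
  finally show ?thesis .
qed

lemma monic_orthogonalI:
  assumes p: "\<And>i. i \<le> m \<Longrightarrow> p i \<in> carrier_mat q q" and "p m = 1\<^sub>m q"
    and "\<And>k. k < m \<Longrightarrow> laurent_coeff q s m p (int (k + e)) = 0\<^sub>m q q"
  shows "monic_orthogonal q (\<lambda>i. s (i + e)) m (\<lambda>i. (- 1) ^ (m - i) \<cdot>\<^sub>m p i)"
proof -
  have "mat_sum q (\<lambda>i. s (i + k + e) * ((- 1) ^ (m - i) \<cdot>\<^sub>m p i)) (Suc m) = 0\<^sub>m q q" if "k < m" for k
    using moment_eq_laurent_coeff[of m p "k + e"] p assms(3)[OF that]
    by (simp add: add.assoc del: mat_sum.simps)
  then show ?thesis using assms by (auto simp: monic_orthogonal_def simp del: mat_sum.simps)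
qed

lemma signed_orthogonal_unique:
  assumes p: "\<And>i. i \<le> m \<Longrightarrow> p i \<in> carrier_mat q q" "p m = 1\<^sub>m q"
      "\<And>k. k < m \<Longrightarrow> laurent_coeff q s m p (int (k + e)) = 0\<^sub>m q q"
    and p': "\<And>i. i \<le> m \<Longrightarrow> p' i \<in> carrier_mat q q" "p' m = 1\<^sub>m q"
      "\<And>k. k < m \<Longrightarrow> laurent_coeff q s m p' (int (k + e)) = 0\<^sub>m q q"
    and pd: "m \<ge> 1 \<Longrightarrow> herm_pos_def (m * q) (H1 q (\<lambda>i. s (i + e)) (m - 1))"
    and "i \<le> m"
  shows "p i = p' i"
proof -
  have "(- 1) ^ (m - i) \<cdot>\<^sub>m p i = (- 1) ^ (m - i) \<cdot>\<^sub>m p' i"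
    using monic_orthogonal_unique[OF s monic_orthogonalI[OF p]
        monic_orthogonalI[OF p'] pd \<open>i \<le> m\<close>] by simp
  then have "(- 1) ^ (m - i) \<cdot>\<^sub>m ((- 1) ^ (m - i) \<cdot>\<^sub>m p i) = (- 1) ^ (m - i) \<cdot>\<^sub>m ((- 1) ^ (m - i) \<cdot>\<^sub>m p' i)"
    by simp
  moreover have "(- 1) ^ (m - i) * (- 1) ^ (m - i) = (1 :: complex)"
    by (simp flip: power_mult_distrib)
  ultimately show ?thesis by (simp add: smult_smult_mat one_smult_mat)
qed

lemma sign_cancel:
  fixes X Y :: "complex mat"
  assumes "X \<in> carrier_mat q q" "Y \<in> carrier_mat q q"
  shows "((- 1) ^ m \<cdot>\<^sub>m X) * Y * mat_adjoint ((- 1) ^ m \<cdot>\<^sub>m X) = X * Y * mat_adjoint X"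
proof -
  have "(- 1) ^ m * (- 1) ^ m = (1 :: complex)" by (simp flip: power_mult_distrib)
  moreover have "mat_adjoint X \<in> carrier_mat q q" "X * Y \<in> carrier_mat q q" using assms by auto
  ultimately show ?thesis
    using assms
    by (simp add: adjoint_smult mult_smult_distrib[of _ q q _ q] mult_smult_assoc_mat[of _ q q _ q]
        smult_smult_mat one_smult_mat)
qed

context
  fixes \<kappa> :: nat
  assumes pos: "stieltjes_positive q s \<kappa>"
begin

lemma H1_pos: "2 * j \<le> \<kappa> \<Longrightarrow> herm_pos_def ((j + 1) * q) (H1 q s j)"
  and H2_pos: "2 * j + 1 \<le> \<kappa> \<Longrightarrow> herm_pos_def ((j + 1) * q) (H2 q s j)"
  using pos by (auto simp: stieltjes_positive_def)

text \<open>
  If \<open>p\<close> is monic of degree \<open>m\<close> and \<open>S p\<close> has no powers \<open>z\<^sup>-\<^sup>1, \<dots>, z\<^sup>-\<^sup>m\<close>, then \<open>(-1)\<^sup>m p(-z)\<close> is the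
  orthogonal polynomial. This identifies the next Laurent coefficient and the weight; the signs
  cancel in the weight because it is quadratic in the constant coefficient.
\<close>

lemma even_orthogonal:
  assumes "2 * m \<le> \<kappa>" and p: "\<And>i. i \<le> m \<Longrightarrow> p i \<in> carrier_mat q q" and "p m = 1\<^sub>m q"
    and "\<And>k. k < m \<Longrightarrow> laurent_coeff q s m p (int k) = 0\<^sub>m q q"
  shows "herm_pos_def q (H1hat q s m)" "H1hat q s m = laurent_coeff q s m p (int m)"
    and "P1_0 q s m = p 0 * minv (H1hat q s m) * mat_adjoint (p 0)"
proof -
  have x: "monic_orthogonal q s m (\<lambda>i. (- 1) ^ (m - i) \<cdot>\<^sub>m p i)"
    using monic_orthogonalI[of m p 0] assms by simp
  have pd: "herm_pos_def ((m + 1) * q) (H1 q s m)" using H1_pos assms(1) .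
  have pd': "herm_pos_def (m * q) (H1 q s (m - 1))" if "m \<ge> 1"
    using H1_pos[of "m - 1"] assms(1) that by simp
  show Hpd: "herm_pos_def q (H1hat q s m)" by (rule H1hat_pos_def[OF s x pd pd'])
  have "H1hat q s m = mat_sum q (\<lambda>i. s (i + m) * ((- 1) ^ (m - i) \<cdot>\<^sub>m p i)) (Suc m)"
    by (rule H1hat_eq_last_moment[OF s x pd pd'])
  also have "\<dots> = (- 1) ^ (m + m) \<cdot>\<^sub>m laurent_coeff q s m p (int m)"
    by (rule moment_eq_laurent_coeff[OF p])
  also have "\<dots> = laurent_coeff q s m p (int m)" by (simp add: minus_one_power_iff one_smult_mat)
  finally show "H1hat q s m = laurent_coeff q s m p (int m)" .
  have "P1 q s m 0 = mat_adjoint ((- 1) ^ m \<cdot>\<^sub>m p 0)"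
    using P1_at_0[OF s x pd pd'] by simp
  then show "P1_0 q s m = p 0 * minv (H1hat q s m) * mat_adjoint (p 0)"
    unfolding P1_0_def using sign_cancel p[of 0] minv_pos_def(1)[OF Hpd] by simp
qed

text \<open>
  The counterpart for \<open>z S p\<close> and the shifted moments. Up to sign, the value of \<open>Q2\<close> at \<open>0\<close> is the
  adjoint of the coefficient of \<open>z\<^sup>0\<close> in \<open>z S p\<close>.
\<close>

lemma odd_orthogonal:
  assumes "2 * m + 1 \<le> \<kappa>" and p: "\<And>i. i \<le> m \<Longrightarrow> p i \<in> carrier_mat q q" and "p m = 1\<^sub>m q"
    and "\<And>k. k < m \<Longrightarrow> laurent_coeff q s m p (int (Suc k)) = 0\<^sub>m q q"
  shows "herm_pos_def q (H2hat q s m)" "H2hat q s m = - laurent_coeff q s m p (int (Suc m))"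
    and "Q2_0 q s m = laurent_coeff q s m p 0 * minv (H2hat q s m) * mat_adjoint (laurent_coeff q s m p 0)"
proof -
  have x: "monic_orthogonal q (\<lambda>i. s (Suc i)) m (\<lambda>i. (- 1) ^ (m - i) \<cdot>\<^sub>m p i)"
    using monic_orthogonalI[of m p 1] assms by simp
  have pd: "herm_pos_def ((m + 1) * q) (H2 q s m)" using H2_pos assms(1) .
  have pd': "herm_pos_def (m * q) (H2 q s (m - 1))" if "m \<ge> 1"
    using H2_pos[of "m - 1"] assms(1) that by simp
  note pds = pd[unfolded H2_eq_H1_shift] pd'[unfolded H2_eq_H1_shift]
  show Hpd: "herm_pos_def q (H2hat q s m)"
    unfolding H2hat_eq_H1hat_shift by (rule H1hat_pos_def[OF s x pds])
  have c: "laurent_coeff q s m p k \<in> carrier_mat q q" for k using p by (rule laurent_coeff_carrier)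
  have "H1hat q (\<lambda>i. s (Suc i)) m
      = mat_sum q (\<lambda>i. s (Suc (i + m)) * ((- 1) ^ (m - i) \<cdot>\<^sub>m p i)) (Suc m)"
    by (rule H1hat_eq_last_moment[OF s x pds])
  also have "\<dots> = mat_sum q (\<lambda>i. s (i + Suc m) * ((- 1) ^ (m - i) \<cdot>\<^sub>m p i)) (Suc m)"
    by (simp only: add_Suc_right)
  also have "\<dots> = (- 1) ^ (m + Suc m) \<cdot>\<^sub>m laurent_coeff q s m p (int (Suc m))"
    by (rule moment_eq_laurent_coeff[OF p])
  also have "\<dots> = - laurent_coeff q s m p (int (Suc m))"
    by (intro eq_matI) (auto simp: minus_one_power_iff)
  finally show "H2hat q s m = - laurent_coeff q s m p (int (Suc m))"
    unfolding H2hat_eq_H1hat_shift .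
  have "mat_adjoint (s 0) = s 0"
    by (rule H1_herm_entries[OF s H1_pos[of 0]]) auto
  then have "Q2 q s m 0 = mat_adjoint ((- 1) ^ m \<cdot>\<^sub>m laurent_coeff q s m p 0)"
    using Q2_at_0[OF s _ x pd pd'] moment_eq_laurent_coeff[of m p 0, OF p] by simp
  then show "Q2_0 q s m = laurent_coeff q s m p 0 * minv (H2hat q s m) * mat_adjoint (laurent_coeff q s m p 0)"
    unfolding Q2_0_def using sign_cancel c[of 0] minv_pos_def(1)[OF Hpd] by simp
qed

end

section \<open>The recurrences of the four families\<close>

text \<open>
  The dimensions of the families depend on those of the weights, which contain inverses \<open>minv\<close> and are
  known to be \<open>q \<times> q\<close> only where the Schur complements are invertible. The hypotheses list exactly the
  weights that enter.
\<close>

lemma Phi_Theta_carrier: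
  assumes "\<And>l. l < m \<Longrightarrow> P1_0 q s l \<in> carrier_mat q q" "\<And>l. l < m \<Longrightarrow> Q2_0 q s l \<in> carrier_mat q q"
  shows "Phi q s i m \<in> carrier_mat q q"
    and "P1_0 q s m \<in> carrier_mat q q \<Longrightarrow> Theta q s i m \<in> carrier_mat q q"
  using assms
proof (induction i arbitrary: m)
  case 0
  { case 1 show ?case by simp }
  { case 2 
    then show ?case by (auto simp del: mat_sum.simps simp: less_Suc_eq intro!: mat_sum_carrier) }
next
  case (Suc i)
  have Phi: "Phi q s (Suc i) m' \<in> carrier_mat q q"
    if "\<And>l. l < m' \<Longrightarrow> P1_0 q s l \<in> carrier_mat q q" "\<And>l. l < m' \<Longrightarrow> Q2_0 q s l \<in> carrier_mat q q" for m'
    using Suc.IH(2) that by (auto intro!: mat_sum_carrier)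
  { case 1 then show ?case by (rule Phi) }
  { case 2
    then have "Phi q s (Suc i) l * P1_0 q s l \<in> carrier_mat q q" if "l < m + 1" for l
      using Phi[of l] that by (auto simp: less_Suc_eq simp del: Phi.simps)
    then show ?case
      by (auto simp del: mat_sum.simps Phi.simps intro!: mat_sum_carrier) }
qed

lemma Phi_Theta_degree:
  assumes "\<And>l. l < m \<Longrightarrow> P1_0 q s l \<in> carrier_mat q q" "\<And>l. l < m \<Longrightarrow> Q2_0 q s l \<in> carrier_mat q q"
  shows "m < i \<Longrightarrow> Phi q s i m = 0\<^sub>m q q"
    and "P1_0 q s m \<in> carrier_mat q q \<Longrightarrow> m < i \<Longrightarrow> Theta q s i m = 0\<^sub>m q q"
  using assms
proof (induction i arbitrary: m)
  case 0
  { case 1 then show ?case by simp }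
  { case 2 then show ?case by simp }
next
  case (Suc i)
  have Phi: "Phi q s (Suc i) m' = 0\<^sub>m q q" if "m' < Suc i"
    "\<And>l. l < m' \<Longrightarrow> P1_0 q s l \<in> carrier_mat q q" "\<And>l. l < m' \<Longrightarrow> Q2_0 q s l \<in> carrier_mat q q" for m'
    using Suc.IH(2) that by (auto intro!: mat_sum_zero left_mult_zero_mat)
  { case 1 then show ?case using Phi by blast }
  { case 2
    then have "Phi q s (Suc i) l * P1_0 q s l = 0\<^sub>m q q" if "l < m + 1" for l
      using Phi[of l] that by (auto simp: less_Suc_eq simp del: Phi.simps intro!: left_mult_zero_mat)
    then show ?case by (auto simp del: mat_sum.simps Phi.simps intro!: mat_sum_zero) }
qed

lemma Theta_Suc:
  assumes "\<And>l. l \<le> Suc m \<Longrightarrow> P1_0 q s l \<in> carrier_mat q q"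
  shows "Theta q s i (Suc m) = Theta q s i m + Phi q s i (Suc m) * P1_0 q s (Suc m)"
proof (cases i)
  case 0
  then show ?thesis using assms[of "Suc m"] by simp
qed simp

lemma laurent_coeff_Theta_Suc:
  assumes P: "\<And>l. l \<le> Suc m \<Longrightarrow> P1_0 q s l \<in> carrier_mat q q"
    and Q: "\<And>l. l \<le> m \<Longrightarrow> Q2_0 q s l \<in> carrier_mat q q"
  shows "laurent_coeff q s (Suc m) (\<lambda>i. Theta q s i (Suc m)) k
    = laurent_coeff q s m (\<lambda>i. Theta q s i m) k
      + laurent_coeff q s (Suc m) (\<lambda>i. Phi q s i (Suc m)) k * P1_0 q s (Suc m)"
proof -
  have \<Phi>: "Phi q s i (Suc m) \<in> carrier_mat q q" for i
    using P Q by (intro Phi_Theta_carrier(1)) auto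
  have \<Theta>: "Theta q s i m \<in> carrier_mat q q" for i
    using P Q by (intro Phi_Theta_carrier(2)) auto
  have "laurent_coeff q s (Suc m) (\<lambda>i. Theta q s i (Suc m)) k
      = laurent_coeff q s (Suc m) (\<lambda>i. Theta q s i m + Phi q s i (Suc m) * P1_0 q s (Suc m)) k"
    using Theta_Suc[OF P] by (intro laurent_coeff_cong) auto
  also have "\<dots> = laurent_coeff q s (Suc m) (\<lambda>i. Theta q s i m) k
      + laurent_coeff q s (Suc m) (\<lambda>i. Phi q s i (Suc m)) k * P1_0 q s (Suc m)"
    using \<Phi> \<Theta> P[of "Suc m"] by (simp add: laurent_coeff_add laurent_coeff_mult_right mult_carrier_square)
  also have "laurent_coeff q s (Suc m) (\<lambda>i. Theta q s i m) k = laurent_coeff q s m (\<lambda>i. Theta q s i m) k"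
    using \<Theta> P Q by (intro laurent_coeff_extend Phi_Theta_degree(2)) auto
  finally show ?thesis .
qed

text \<open>
  The factor \<open>z\<close> in \<open>\<Phi>\<^sub>m\<^sub>+\<^sub>1 = \<Phi>\<^sub>m + z \<Theta>\<^sub>m L\<^sub>m\<close> raises the index of the Laurent coefficient by one.
\<close>

lemma laurent_coeff_Phi_Suc:
  assumes P: "\<And>l. l \<le> m \<Longrightarrow> P1_0 q s l \<in> carrier_mat q q"
    and Q: "\<And>l. l \<le> m \<Longrightarrow> Q2_0 q s l \<in> carrier_mat q q"
  shows "laurent_coeff q s (Suc m) (\<lambda>i. Phi q s i (Suc m)) k
    = laurent_coeff q s m (\<lambda>i. Phi q s i m) k
      + laurent_coeff q s m (\<lambda>i. Theta q s i m) (k + 1) * Q2_0 q s m"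
proof -
  have \<Phi>': "Phi q s i (Suc m) \<in> carrier_mat q q" for i
    using P Q by (intro Phi_Theta_carrier(1)) auto
  have \<Phi>: "Phi q s i m \<in> carrier_mat q q" for i
    using P Q by (intro Phi_Theta_carrier(1)) auto
  have \<Theta>: "Theta q s i m \<in> carrier_mat q q" for i
    using P Q by (intro Phi_Theta_carrier(2)) auto
  let ?a = "signed_moment q s k * 1\<^sub>m q"
  let ?b = "laurent_coeff q s m (\<lambda>i. Phi q s (Suc i) m) (k + 1)"
  let ?c = "laurent_coeff q s m (\<lambda>i. Theta q s i m) (k + 1) * Q2_0 q s m"
  have "laurent_coeff q s (Suc m) (\<lambda>i. Phi q s i (Suc m)) k
      = ?a + laurent_coeff q s m (\<lambda>i. Phi q s (Suc i) m + Theta q s i m * Q2_0 q s m) (k + 1)"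
    using \<Phi>' by (subst laurent_coeff_Suc) auto
  also have "\<dots> = ?a + (?b + ?c)"
    using \<Phi> \<Theta> Q[of m]
    by (simp add: laurent_coeff_add laurent_coeff_mult_right mult_carrier_square del: Phi.simps)
  also have "\<dots> = ?a + ?b + ?c"
    using \<Phi> \<Theta> Q[of m]
    by (intro assoc_add_mat[symmetric, of _ q q] laurent_coeff_carrier mult_carrier_square)
      (auto simp del: Phi.simps)
  also have "?a + ?b = laurent_coeff q s (Suc m) (\<lambda>i. Phi q s i m) k"
    using \<Phi> by (subst laurent_coeff_Suc) auto
  also have "\<dots> = laurent_coeff q s m (\<lambda>i. Phi q s i m) k"
    using \<Phi> P Q by (intro laurent_coeff_extend Phi_Theta_degree(1)) auto
  finally show ?thesis .
qed

end

section \<open>Orthogonality of the families\<close>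

text \<open>
  The state of the induction before the weight \<open>M\<^sub>m\<close> is used: \<open>\<Phi>\<^sub>m E\<^sub>m\<close> has leading coefficient \<open>I\<close>, the
  polynomial part of \<open>S \<Phi>\<^sub>m\<close> is \<open>\<Psi>\<^sub>m\<close>, and the powers \<open>z\<^sup>-\<^sup>1, \<dots>, z\<^sup>-\<^sup>m\<close> are absent from \<open>S \<Phi>\<^sub>m\<close>. The last
  clause records the leading coefficient of the previous remainder \<open>\<sigma>\<^sub>m\<^sub>-\<^sub>1\<close>, which \<open>M\<^sub>m\<close> has to cancel.
\<close>

definition Stieltjes_even :: "nat \<Rightarrow> (nat \<Rightarrow> complex mat) \<Rightarrow> nat \<Rightarrow> bool" where
  "Stieltjes_even q s m \<longleftrightarrow>
     (\<forall>l<m. P1_0 q s l \<in> carrier_mat q q \<and> Q2_0 q s l \<in> carrier_mat q q) \<and>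
     even_prod q s m \<in> carrier_mat q q \<and>
     Phi q s m m * even_prod q s m = 1\<^sub>m q \<and>
     (\<forall>k<m. laurent_coeff q s m (\<lambda>i. Phi q s i m) (int k) = 0\<^sub>m q q) \<and>
     (\<forall>j. Psi q s j m = laurent_coeff q s m (\<lambda>i. Phi q s i m) (- int (Suc j))) \<and>
     (\<forall>l. m = Suc l \<longrightarrow>
        herm_pos_def q (H2hat q s l) \<and>
        mat_adjoint (odd_prod q s l) * even_prod q s m = H2hat q s l \<and>
        laurent_coeff q s l (\<lambda>i. Theta q s i l) (int m) = - mat_adjoint (even_prod q s m))"

text \<open>
  The state before the weight \<open>L\<^sub>m\<close> is used, with the roles of \<open>S\<close> and \<open>z S\<close> exchanged. For \<open>j = 0\<close> the
  clause about \<open>Xi\<close> says that \<open>z S \<Theta>\<^sub>m\<close> has the constant term \<open>I\<close>. The last clause is the leading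
  coefficient of \<open>\<rho>\<^sub>m\<close>, which \<open>L\<^sub>m\<close> has to cancel.
\<close>

definition Stieltjes_odd :: "nat \<Rightarrow> (nat \<Rightarrow> complex mat) \<Rightarrow> nat \<Rightarrow> bool" where
  "Stieltjes_odd q s m \<longleftrightarrow>
     P1_0 q s m \<in> carrier_mat q q \<and>
     odd_prod q s m \<in> carrier_mat q q \<and>
     Theta q s m m * odd_prod q s m = 1\<^sub>m q \<and>
     (\<forall>k<m. laurent_coeff q s m (\<lambda>i. Theta q s i m) (int (Suc k)) = 0\<^sub>m q q) \<and>
     (\<forall>j. Xi q s j m = laurent_coeff q s m (\<lambda>i. Theta q s i m) (- int j)) \<and>
     herm_pos_def q (H1hat q s m) \<and>
     mat_adjoint (odd_prod q s m) * even_prod q s m = H1hat q s m \<and>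
     laurent_coeff q s m (\<lambda>i. Phi q s i m) (int m) = mat_adjoint (odd_prod q s m)"

context
  fixes q \<kappa> :: nat and s :: "nat \<Rightarrow> complex mat"
  assumes s: "\<And>i. s i \<in> carrier_mat q q"
    and pos: "stieltjes_positive q s \<kappa>"
begin

lemma Stieltjes_even_0: "Stieltjes_even q s 0"
proof -
  have "Psi q s j 0 = 0\<^sub>m q q" for j by (cases j) auto
  moreover have "laurent_coeff q s 0 (\<lambda>i. Phi q s i 0) (- int (Suc j)) = 0\<^sub>m q q" for j
    by (simp add: laurent_coeff_def signed_moment_def)
  ultimately show ?thesis by (auto simp: Stieltjes_even_def)
qed

text \<open>
  Orthogonality of \<open>\<Phi>\<^sub>m E\<^sub>m\<close> gives \<open>M\<^sub>m = E\<^sub>m D\<^sub>m\<^sup>-\<^sup>1\<close>, and the recurrence then adds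
  \<open>D\<^sub>m\<^sup>* M\<^sub>m = E\<^sub>m\<^sup>*\<close> to the leading coefficient \<open>-E\<^sub>m\<^sup>*\<close> of \<open>\<sigma>\<^sub>m\<^sub>-\<^sub>1\<close>. For \<open>m = 0\<close> there is no previous
  remainder, and \<open>M\<^sub>0 = s\<^sub>0\<^sup>-\<^sup>1\<close> makes the constant term of \<open>z S \<Theta>\<^sub>0\<close> equal to \<open>I\<close>.
\<close>

lemma Stieltjes_odd_if_even:
  assumes m: "2 * m \<le> \<kappa>" and even: "Stieltjes_even q s m"
    and odd: "\<And>l. m = Suc l \<Longrightarrow> Stieltjes_odd q s l"
  shows "Stieltjes_odd q s m"
proof -
  define E where "E = even_prod q s m"
  define D where "D = odd_prod q s m"
  define M where "M = P1_0 q s m"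
  define h where "h = H1hat q s m"
  let ?\<Phi> = "\<lambda>i. Phi q s i m" and ?\<Theta> = "\<lambda>i. Theta q s i m"
  have carr: "P1_0 q s l \<in> carrier_mat q q" "Q2_0 q s l \<in> carrier_mat q q" if "l < m" for l
    using even that by (auto simp: Stieltjes_even_def)
  have E: "E \<in> carrier_mat q q" "Phi q s m m * E = 1\<^sub>m q"
    using even by (auto simp: Stieltjes_even_def E_def)
  have orth: "laurent_coeff q s m ?\<Phi> (int k) = 0\<^sub>m q q" if "k < m" for k
    using even that by (auto simp: Stieltjes_even_def)
  have \<Phi>: "Phi q s i m \<in> carrier_mat q q" for i using Phi_Theta_carrier(1)[OF s carr] .
  \<comment> \<open>The leading coefficient of \<open>\<Phi>\<^sub>m\<close> is a left inverse of \<open>E\<close>, hence an inverse.\<close>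
  have inv: "E * Phi q s m m = 1\<^sub>m q" using mat_mult_left_right_inverse[OF \<Phi> E] .
  have lcE: "laurent_coeff q s m (\<lambda>i. Phi q s i m * E) k = laurent_coeff q s m ?\<Phi> k * E" for k
    using laurent_coeff_mult_right[OF s \<Phi> E(1)] .
  have c: "laurent_coeff q s m ?\<Phi> k \<in> carrier_mat q q" for k using laurent_coeff_carrier[OF s \<Phi>] .
  have lc0: "laurent_coeff q s m (\<lambda>i. Phi q s i m * E) (int k) = 0\<^sub>m q q" if "k < m" for k
    using lcE orth[OF that] E(1) by simp
  have \<Phi>E: "Phi q s i m * E \<in> carrier_mat q q" for i using \<Phi> E by auto
  note link = even_orthogonal[OF s pos m \<Phi>E E(2) lc0, folded h_def]
  have h: "herm_pos_def q h" by (rule link(1))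
  then have hc: "h \<in> carrier_mat q q" by (auto simp: herm_pos_def_def)
  have rE: "laurent_coeff q s m ?\<Phi> (int m) * E = h" using link(2) lcE by simp
  have M: "M = E * minv h * mat_adjoint E"
    using link(3) E(1) by (simp add: M_def)
  \<comment> \<open>As \<open>E\<^sup>* D\<^sub>m\<^sub>-\<^sub>1 = H2hat\<^sub>m\<^sub>-\<^sub>1\<close>, the factors appended to \<open>D\<^sub>m\<^sub>-\<^sub>1\<close> cancel this Schur complement and
      leave \<open>H1hat\<^sub>m\<close>.\<close>
  have D: "D \<in> carrier_mat q q \<and> mat_adjoint E * D = h"
  proof (cases m)
    case 0
    have "s 0 = h" by (simp add: h_def H1hat_def 0)
    then show ?thesis using hc 0 by (simp add: E_def D_def h_def)
  next
    case (Suc l)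
    define D' where "D' = odd_prod q s l"
    define g where "g = H2hat q s l"
    have g: "herm_pos_def q g" "mat_adjoint D' * E = g"
      using even Suc by (auto simp: Stieltjes_even_def E_def D'_def g_def)
    have gc: "g \<in> carrier_mat q q" "mat_adjoint g = g" using g(1) by (auto simp: herm_pos_def_def)
    have D': "D' \<in> carrier_mat q q" using odd[OF Suc] by (auto simp: Stieltjes_odd_def D'_def)
    have P_eq: "D = D' * minv g * h" by (simp add: D_def D'_def g_def h_def Suc)
    note gi = minv_pos_def[OF g(1)]
    have "mat_adjoint E * D' = g"
      by (rule adjoint_product_hermitian[OF D' E(1) g(2) gc(2)])
    moreover have "mat_adjoint E * D = mat_adjoint E * D' * minv g * h"
      unfolding P_eq using D' gi(1) hc adjoint_carrier[OF E(1)]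
      by (simp add: assoc_mult_mat[of _ q q _ q _ q] mult_carrier_square)
    ultimately show ?thesis using gi D' hc by (auto simp: P_eq)
  qed
  note fac = pos_def_factor[OF h E(1) conjunct1[OF D] conjunct2[OF D] M]
  have Mc: "M \<in> carrier_mat q q" "M * D = E" "mat_adjoint D * M = mat_adjoint E" by (rule fac)+
  have Pa: "mat_adjoint D \<in> carrier_mat q q" using D by auto
  have PE: "mat_adjoint D * E = h"
    using D h by (intro adjoint_product_hermitian[OF E(1)]) (auto simp: herm_pos_def_def)
  have r: "laurent_coeff q s m ?\<Phi> (int m) = mat_adjoint D"
    by (rule right_cancel_mat[OF _ inv c Pa E(1) \<Phi>]) (simp only: rE PE)
  have carrM: "P1_0 q s l \<in> carrier_mat q q" if "l \<le> m" for l
    using carr[of l] Mc(1) that by (cases "l = m") (auto simp: M_def)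
  have \<Theta>: "Theta q s i m \<in> carrier_mat q q" for i
    using Phi_Theta_carrier(2)[OF s carr] Mc(1) by (simp add: M_def)
  have "Theta q s m m = Phi q s m m * M \<and>
      (\<forall>k<m. laurent_coeff q s m ?\<Theta> (int (Suc k)) = 0\<^sub>m q q) \<and>
      (\<forall>j. Xi q s j m = laurent_coeff q s m ?\<Theta> (- int j))"
  proof (cases m)
    case 0
    have T: "Theta q s i 0 = Phi q s i 0 * M" for i
      using \<Phi>[of i] Mc(1) 0 by (cases i) (auto simp: M_def)
    have "laurent_coeff q s m ?\<Theta> k = laurent_coeff q s m ?\<Phi> k * M" for k
      using laurent_coeff_mult_right[OF s \<Phi> Mc(1)] T 0 by simp
    moreover have "laurent_coeff q s m ?\<Phi> 0 * M = 1\<^sub>m q"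
      using r Mc(3) 0 by (simp add: E_def)
    moreover have "Xi q s (Suc j) m = 0\<^sub>m q q" for j
      using Mc(1) 0 by (cases j) (auto simp: M_def intro!: left_mult_zero_mat)
    moreover have "laurent_coeff q s m ?\<Phi> (- int (Suc j)) = 0\<^sub>m q q" for j
      using 0 by (simp add: laurent_coeff_def signed_moment_def)
    ultimately have "Xi q s j m = laurent_coeff q s m ?\<Theta> (- int j)" for j
      using Mc(1) by (cases j) (auto simp del: of_nat_Suc)
    then show ?thesis using T[of 0] 0 by (simp del: Theta.simps Phi.simps Xi.simps)
  next
    case (Suc l)
    have Q: "Q2_0 q s i \<in> carrier_mat q q" if "i \<le> l" for i using carr that Suc by auto
    have rec: "laurent_coeff q s m ?\<Theta> k
        = laurent_coeff q s l (\<lambda>i. Theta q s i l) k + laurent_coeff q s m ?\<Phi> k * M" for k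
      using laurent_coeff_Theta_Suc[OF s carrM[unfolded Suc] Q] unfolding M_def Suc .
    have odd': "\<And>k. k < l \<Longrightarrow> laurent_coeff q s l (\<lambda>i. Theta q s i l) (int (Suc k)) = 0\<^sub>m q q"
        "\<And>j. Xi q s j l = laurent_coeff q s l (\<lambda>i. Theta q s i l) (- int j)"
      using odd[OF Suc] by (auto simp: Stieltjes_odd_def)
    have t: "laurent_coeff q s l (\<lambda>i. Theta q s i l) (int m) = - mat_adjoint E"
      using even Suc by (auto simp: Stieltjes_even_def E_def)
    have \<Theta>l: "Theta q s i l \<in> carrier_mat q q" for i
      using carr Suc by (intro Phi_Theta_carrier(2)[OF s]) auto
    have cl: "laurent_coeff q s l (\<lambda>i. Theta q s i l) k \<in> carrier_mat q q" for k
      using laurent_coeff_carrier[OF s \<Theta>l] .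
    have "Theta q s m l = 0\<^sub>m q q"
      using carr Suc by (intro Phi_Theta_degree(2)[OF s]) auto
    then have "Theta q s m m = Phi q s m m * M"
      using Theta_Suc[OF s, where m = l and i = m] carrM \<Phi>[of m] Mc(1) Suc
      by (simp add: M_def left_add_zero_mat[of _ q q] mult_carrier_square del: Phi.simps Theta.simps)
    moreover have "laurent_coeff q s m ?\<Theta> (int (Suc k)) = 0\<^sub>m q q" if "k < m" for k
    proof (cases "k = l")
      case True
      then have "int (Suc k) = int m" using Suc by simp
      then have "laurent_coeff q s m ?\<Theta> (int (Suc k)) = - mat_adjoint E + mat_adjoint E"
        unfolding rec using t r Mc(3) by simp
      then show ?thesis by (simp only: add_uminus_self_mat[OF adjoint_carrier[OF E(1)]])
    next
      case False
      then show ?thesis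
        unfolding rec using that Suc odd'(1)[of k] orth[of "Suc k"] Mc(1) by (simp del: of_nat_Suc)
    qed
    moreover have "Xi q s j m = laurent_coeff q s m ?\<Theta> (- int j)" for j
    proof (cases j)
      case 0
      then show ?thesis
        unfolding rec using Suc odd'(2)[of 0] orth[of 0] Mc(1) cl[of 0]
        by (simp add: right_add_zero_mat[of _ q q] del: Phi.simps Theta.simps)
    next
      case (Suc j')
      have "Xi q s (Suc j') m = Xi q s (Suc j') l + Psi q s j' m * M"
        unfolding M_def \<open>m = Suc l\<close> by simp
      then show ?thesis
        unfolding rec Suc using even odd'(2)[of "Suc j'"] by (simp add: Stieltjes_even_def)
    qed
    ultimately show ?thesis by blast
  qed
  moreover have "Phi q s m m * M * D = 1\<^sub>m q"
    using \<Phi> Mc(1,2) D E(2) by (simp add: assoc_mult_mat[of _ q q _ q _ q])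
  ultimately show ?thesis
    using h PE r Mc(1) D unfolding Stieltjes_odd_def by (auto simp: M_def D_def E_def h_def)
qed

text \<open>
  Orthogonality of \<open>\<Theta>\<^sub>m D\<^sub>m\<close> gives \<open>L\<^sub>m = D\<^sub>m E\<^sub>m\<^sub>+\<^sub>1\<^sup>-\<^sup>1\<close>; here the constant term \<open>D\<^sub>m\<close> of
  \<open>z S \<Theta>\<^sub>m D\<^sub>m\<close> takes the part of the constant coefficient. The recurrence then adds
  \<open>-E\<^sub>m\<^sub>+\<^sub>1\<^sup>* L\<^sub>m = -D\<^sub>m\<^sup>*\<close> to the leading coefficient \<open>D\<^sub>m\<^sup>*\<close> of \<open>\<rho>\<^sub>m\<close>.
\<close>

lemma Stieltjes_even_Suc:
  assumes m: "2 * m + 1 \<le> \<kappa>" and even: "Stieltjes_even q s m" and odd: "Stieltjes_odd q s m"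
  shows "Stieltjes_even q s (Suc m)"
proof -
  define E where "E = even_prod q s m"
  define E' where "E' = even_prod q s (Suc m)"
  define D where "D = odd_prod q s m"
  define L where "L = Q2_0 q s m"
  define h where "h = H1hat q s m"
  define g where "g = H2hat q s m"
  let ?\<Phi> = "\<lambda>i. Phi q s i m" and ?\<Theta> = "\<lambda>i. Theta q s i m"
  have carr: "P1_0 q s l \<in> carrier_mat q q" "Q2_0 q s l \<in> carrier_mat q q" if "l < m" for l
    using even that by (auto simp: Stieltjes_even_def)
  have odd': "P1_0 q s m \<in> carrier_mat q q" "D \<in> carrier_mat q q" "Theta q s m m * D = 1\<^sub>m q"
    "\<And>k. k < m \<Longrightarrow> laurent_coeff q s m ?\<Theta> (int (Suc k)) = 0\<^sub>m q q"
    "\<And>j. Xi q s j m = laurent_coeff q s m ?\<Theta> (- int j)"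
    "herm_pos_def q h" "mat_adjoint D * E = h" "laurent_coeff q s m ?\<Phi> (int m) = mat_adjoint D"
    using odd by (auto simp: Stieltjes_odd_def D_def E_def h_def)
  have E: "E \<in> carrier_mat q q" using even by (auto simp: Stieltjes_even_def E_def)
  have \<Theta>: "Theta q s i m \<in> carrier_mat q q" for i using Phi_Theta_carrier(2)[OF s carr odd'(1)] .
  have inv: "D * Theta q s m m = 1\<^sub>m q" using mat_mult_left_right_inverse[OF \<Theta> odd'(2,3)] .
  have lcP: "laurent_coeff q s m (\<lambda>i. Theta q s i m * D) k = laurent_coeff q s m ?\<Theta> k * D" for k
    using laurent_coeff_mult_right[OF s \<Theta> odd'(2)] .
  have c: "laurent_coeff q s m ?\<Theta> k \<in> carrier_mat q q" for k using laurent_coeff_carrier[OF s \<Theta>] .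
  have lc0: "laurent_coeff q s m (\<lambda>i. Theta q s i m * D) (int (Suc k)) = 0\<^sub>m q q" if "k < m" for k
    using lcP odd'(4)[OF that] odd'(2) by simp
  have \<Theta>D: "Theta q s i m * D \<in> carrier_mat q q" for i using \<Theta> odd'(2) by auto
  note link = odd_orthogonal[OF s pos m \<Theta>D odd'(3) lc0, folded g_def]
  have g: "herm_pos_def q g" by (rule link(1))
  then have gc: "g \<in> carrier_mat q q" by (auto simp: herm_pos_def_def)
  have tP: "- (laurent_coeff q s m ?\<Theta> (int (Suc m)) * D) = g"
    using link(2) lcP by simp
  have "laurent_coeff q s m ?\<Theta> 0 = 1\<^sub>m q" using odd'(5)[of 0] by simp
  then have L: "L = D * minv g * mat_adjoint D"
    using link(3) odd'(2) unfolding lcP by (simp add: L_def)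
  have Pa: "mat_adjoint D \<in> carrier_mat q q" using odd'(2) by auto
  note hi = minv_pos_def[OF odd'(6)]
  have E'_eq: "E' = E * minv h * g" by (simp add: E_def E'_def h_def g_def)
  have E': "E' \<in> carrier_mat q q" unfolding E'_eq using E hi(1) gc by auto
  have "mat_adjoint D * E' = mat_adjoint D * E * minv h * g"
    unfolding E'_eq using E hi(1) gc Pa
    by (simp add: assoc_mult_mat[of _ q q _ q _ q] mult_carrier_square)
  then have PE': "mat_adjoint D * E' = g" using odd'(7) hi gc by simp
  note fac = pos_def_factor[OF g odd'(2) E' PE' L]
  have E'a: "mat_adjoint E' \<in> carrier_mat q q" using E' by auto
  have E'D: "mat_adjoint E' * D = g"
    using PE' g by (intro adjoint_product_hermitian[OF odd'(2) E']) (auto simp: herm_pos_def_def)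
  have "laurent_coeff q s m ?\<Theta> (int (Suc m)) * D = - g"
    unfolding tP[symmetric] by (rule eq_matI) auto
  also have "\<dots> = - mat_adjoint E' * D"
    unfolding E'D[symmetric] using odd'(2) E' by simp
  finally have t: "laurent_coeff q s m ?\<Theta> (int (Suc m)) = - mat_adjoint E'"
    by (rule right_cancel_mat[OF _ inv c uminus_carrier_mat[OF E'a] odd'(2) \<Theta>])
  have carr': "P1_0 q s l \<in> carrier_mat q q \<and> Q2_0 q s l \<in> carrier_mat q q" if "l < Suc m" for l
    using carr[of l] odd'(1) fac(1) that by (cases "l = m") (auto simp: L_def)
  have \<Phi>: "Phi q s i m \<in> carrier_mat q q" for i using Phi_Theta_carrier(1)[OF s carr] .
  have rec: "laurent_coeff q s (Suc m) (\<lambda>i. Phi q s i (Suc m)) k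
      = laurent_coeff q s m ?\<Phi> k + laurent_coeff q s m ?\<Theta> (k + 1) * L" for k
    unfolding L_def using carr' by (intro laurent_coeff_Phi_Suc[OF s]) auto
  have "laurent_coeff q s (Suc m) (\<lambda>i. Phi q s i (Suc m)) (int k) = 0\<^sub>m q q" if "k < Suc m" for k
  proof (cases "k = m")
    case True
    have "- mat_adjoint E' * L = - mat_adjoint D"
      using fac(3) E' fac(1) by simp
    moreover have "int m + 1 = int (Suc m)" by simp
    ultimately have "laurent_coeff q s m ?\<Theta> (int m + 1) * L = - mat_adjoint D"
      using t by (simp only:)
    then have "laurent_coeff q s (Suc m) (\<lambda>i. Phi q s i (Suc m)) (int k) = mat_adjoint D + - mat_adjoint D"
      unfolding rec True odd'(8) by simp
    then show ?thesis by (simp only: add_uminus_self_mat[OF Pa])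
  next
    case False
    then have "laurent_coeff q s m ?\<Phi> (int k) = 0\<^sub>m q q" using even that by (auto simp: Stieltjes_even_def)
    then show ?thesis
      unfolding rec using odd'(4)[of k] False that fac(1) by (simp add: add.commute)
  qed
  moreover have "Psi q s j (Suc m) = laurent_coeff q s (Suc m) (\<lambda>i. Phi q s i (Suc m)) (- int (Suc j))" for j
  proof -
    have "Psi q s j (Suc m) = Psi q s j m + Xi q s j m * L"
    proof (cases j)
      case 0
      then show ?thesis using fac(1) by (simp add: L_def)
    qed (simp add: L_def)
    moreover have shift: "- int (Suc j) + 1 = - int j" by simp
    moreover have "Psi q s j m = laurent_coeff q s m ?\<Phi> (- int (Suc j))"
      using even by (simp add: Stieltjes_even_def)
    ultimately show ?thesis unfolding rec odd'(5)[of j] shift by simp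
  qed
  moreover have "Phi q s (Suc m) (Suc m) * E' = 1\<^sub>m q"
  proof -
    have "Phi q s (Suc m) m = 0\<^sub>m q q" using carr by (intro Phi_Theta_degree(1)[OF s]) auto
    then have "Phi q s (Suc m) (Suc m) = Theta q s m m * L"
      using \<Theta> fac(1) by (simp add: L_def left_add_zero_mat[of _ q q] mult_carrier_square)
    then show ?thesis
      using \<Theta> fac(1,2) E' odd'(3) by (simp add: assoc_mult_mat[of _ q q _ q _ q])
  qed
  ultimately show ?thesis
    using carr' E' g PE' t unfolding Stieltjes_even_def
    by (auto simp del: even_prod.simps of_nat_Suc simp: E'_def D_def g_def)
qed

lemma Stieltjes_even_odd:
  "(2 * m \<le> \<kappa> + 1 \<longrightarrow> Stieltjes_even q s m) \<and> (2 * m \<le> \<kappa> \<longrightarrow> Stieltjes_odd q s m)"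
proof (induction m)
  case 0
  show ?case using Stieltjes_even_0 Stieltjes_odd_if_even[of 0] by auto
next
  case (Suc m)
  then have "Stieltjes_even q s (Suc m)" if "2 * Suc m \<le> \<kappa> + 1"
    using that by (intro Stieltjes_even_Suc) auto
  then show ?case using Suc Stieltjes_odd_if_even[of "Suc m"] by auto
qed

end

section \<open>Power series and determinants near a point\<close>

lemma power_series_zero:
  fixes a :: "nat \<Rightarrow> complex"
  assumes "r > 0" and sums: "\<And>w. w \<noteq> 0 \<Longrightarrow> norm w < r \<Longrightarrow> (\<lambda>k. a k * w ^ k) sums 0"
  shows "a k = 0"
proof (induction k rule: less_induct)
  case (less k)
  have "((\<lambda>_. 0) \<longlongrightarrow> a (0 + k)) (at (0 :: complex))"
  proof (rule powser_limit_0_strong[OF \<open>r > 0\<close>])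
    fix w :: complex assume w: "w \<noteq> 0" "norm w < r"
    have "(\<lambda>i. a (i + k) * w ^ (i + k)) sums 0"
      using sums[OF w] less by (subst sums_iff_shift) simp
    then have "(\<lambda>i. (a (i + k) * w ^ (i + k)) * inverse (w ^ k)) sums (0 * inverse (w ^ k))"
      by (rule sums_mult2)
    moreover have "(a (i + k) * w ^ (i + k)) * inverse (w ^ k) = a (i + k) * w ^ i" for i
      using w by (simp add: power_add)
    ultimately show "(\<lambda>i. a (i + k) * w ^ i) sums 0" by simp
  qed
  then show ?case using LIM_unique[OF tendsto_const[of 0]] by simp
qed

lemma sums_shift_up:
  fixes f :: "nat \<Rightarrow> complex"
  assumes "f sums S"
  shows "(\<lambda>k. if l \<le> k then f (k - l) else 0) sums S"
proof -
  have "(\<lambda>k. (\<lambda>k. if l \<le> k then f (k - l) else 0) (k + l)) sums S" using assms by simp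
  then show ?thesis by (subst (asm) sums_iff_shift) simp
qed

lemma tendsto_det:
  fixes D :: "complex \<Rightarrow> complex mat"
  assumes D: "\<And>w. D w \<in> carrier_mat q q"
    and lim: "\<And>a b. a < q \<Longrightarrow> b < q \<Longrightarrow> ((\<lambda>w. D w $$ (a, b)) \<longlongrightarrow> M $$ (a, b)) F"
    and M: "M \<in> carrier_mat q q"
  shows "((\<lambda>w. det (D w)) \<longlongrightarrow> det M) F"
proof -
  have "((\<lambda>w. \<Sum>p\<in>{p. p permutes {0..<q}}. signof p * (\<Prod>i = 0..<q. D w $$ (i, p i)))
      \<longlongrightarrow> (\<Sum>p\<in>{p. p permutes {0..<q}}. signof p * (\<Prod>i = 0..<q. M $$ (i, p i)))) F"
  proof (intro tendsto_sum tendsto_mult tendsto_const tendsto_prod lim)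
    fix p i assume "p \<in> {p. p permutes {0..<q}}" "i \<in> {0..<q}"
    then show "i < q" "p i < q" using permutes_in_image[of p "{0..<q}" i] by auto
  qed
  then show ?thesis using D M by (simp add: det_def'[of _ q])
qed

section \<open>The relation between the coefficients and the Markov parameters\<close>

text \<open>
  With these two polynomials the ratio is \<open>numerator * denominator\<^sup>-\<^sup>1\<close> for both parities of \<open>n\<close>. The
  denominator is monic of degree \<open>(n + 1) div 2\<close>, and the numerator has smaller degree.
\<close>

definition numerator :: "nat \<Rightarrow> nat \<Rightarrow> (nat \<Rightarrow> complex mat) \<Rightarrow> complex \<Rightarrow> complex mat" where
  "numerator q n A z = (if even n then g_part q n A z else h_part q n A z)"

definition denominator :: "nat \<Rightarrow> nat \<Rightarrow> (nat \<Rightarrow> complex mat) \<Rightarrow> complex \<Rightarrow> complex mat" where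
  "denominator q n A z = (if even n then h_part q n A z else z \<cdot>\<^sub>m g_part q n A z)"

context
  fixes q n :: nat and A s :: "nat \<Rightarrow> complex mat"
  assumes A0: "A 0 = 1\<^sub>m q" and A: "\<And>j. j \<le> n \<Longrightarrow> A j \<in> carrier_mat q q"
    and mk: "markov_params q n A s"
begin

lemma markov_params_carrier: "s i \<in> carrier_mat q q"
  using mk by (auto simp: markov_params_def)

lemma A_smult_entry: "j \<le> n \<Longrightarrow> a < q \<Longrightarrow> b < q \<Longrightarrow> (c \<cdot>\<^sub>m A j) $$ (a, b) = c * A j $$ (a, b)"
  using A[of j] by auto

lemma denominator_carrier: "denominator q n A z \<in> carrier_mat q q"
  and numerator_carrier: "numerator q n A z \<in> carrier_mat q q"
  using A by (auto simp: denominator_def numerator_def h_part_def g_part_def Let_def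
      simp del: mat_sum.simps intro!: mat_sum_carrier smult_carrier_mat elim!: evenE oddE)

lemma denominator_entry:
  assumes "a < q" "b < q" "w \<noteq> 0"
  shows "w ^ ((n + 1) div 2) * denominator q n A (inverse w) $$ (a, b)
    = (\<Sum>l<Suc (n div 2). w ^ l * A (2 * l) $$ (a, b))"
proof -
  define d where "d = (n + 1) div 2"
  have le: "2 * l \<le> n" if "l < Suc (n div 2)" for l using that by auto
  have Ac: "c \<cdot>\<^sub>m A (2 * l) \<in> carrier_mat q q" if "l < Suc (n div 2)" for l c using A[OF le[OF that]] by auto
  have ld: "l \<le> d" if "l < Suc (n div 2)" for l using that by (auto simp: d_def)
  have "denominator q n A (inverse w) $$ (a, b)
      = (\<Sum>l<Suc (n div 2). inverse w ^ (d - l) * A (2 * l) $$ (a, b))"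
  proof (cases "even n")
    case True
    then have "denominator q n A (inverse w)
        = mat_sum q (\<lambda>l. inverse w ^ (d - l) \<cdot>\<^sub>m A (2 * l)) (Suc (n div 2))"
      by (simp add: denominator_def h_part_def Let_def d_def del: mat_sum.simps)
    then show ?thesis
      using assms Ac le by (simp add: mat_sum_index A_smult_entry del: mat_sum.simps index_smult_mat sum.lessThan_Suc)
  next
    case False
    then have "denominator q n A (inverse w)
        = inverse w \<cdot>\<^sub>m mat_sum q (\<lambda>l. inverse w ^ (n div 2 - l) \<cdot>\<^sub>m A (2 * l)) (Suc (n div 2))"
      by (simp add: denominator_def g_part_def Let_def d_def del: mat_sum.simps)
    moreover have "mat_sum q (\<lambda>l. inverse w ^ (n div 2 - l) \<cdot>\<^sub>m A (2 * l)) (Suc (n div 2)) \<in> carrier_mat q q"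
      using Ac by (rule mat_sum_carrier)
    moreover have "inverse w * inverse w ^ (n div 2 - l) = inverse w ^ (d - l)"
      if "l < Suc (n div 2)" for l
    proof -
      have "d - l = Suc (n div 2 - l)" using that False by (auto simp: d_def elim!: oddE)
      then show ?thesis by simp
    qed
    ultimately show ?thesis
      using assms Ac le
      by (simp add: mat_sum_index A_smult_entry sum_distrib_left mult.assoc[symmetric]
          del: mat_sum.simps sum.lessThan_Suc)
  qed
  moreover have "w ^ d * inverse w ^ (d - l) = w ^ l" if "l < Suc (n div 2)" for l
  proof -
    have "w ^ d = w ^ l * w ^ (d - l)" using ld[OF that] by (simp flip: power_add)
    then show ?thesis using \<open>w \<noteq> 0\<close> by (simp add: power_inverse)
  qed
  ultimately show ?thesis
    unfolding d_def[symmetric] by (simp add: sum_distrib_left mult.assoc[symmetric] del: sum.lessThan_Suc)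
qed

lemma numerator_entry:
  assumes "a < q" "b < q" "w \<noteq> 0"
  shows "w ^ ((n + 1) div 2) * numerator q n A (inverse w) $$ (a, b)
    = w * (\<Sum>l<(n + 1) div 2. w ^ l * A (2 * l + 1) $$ (a, b))"
proof -
  define d where "d = (n + 1) div 2"
  have le: "2 * l + 1 \<le> n" if "l < d" for l using that by (auto simp: d_def)
  have Ac: "c \<cdot>\<^sub>m A (2 * l + 1) \<in> carrier_mat q q" if "l < d" for l c using A[OF le[OF that]] by auto
  have "numerator q n A (inverse w) = mat_sum q (\<lambda>l. inverse w ^ (d - Suc l) \<cdot>\<^sub>m A (2 * l + 1)) d"
    by (cases "even n")
      (auto simp: numerator_def g_part_def h_part_def Let_def d_def simp del: mat_sum.simps elim!: evenE oddE)
  then have "numerator q n A (inverse w) $$ (a, b)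
      = (\<Sum>l<d. inverse w ^ (d - Suc l) * A (2 * l + 1) $$ (a, b))"
    using assms Ac le by (simp add: mat_sum_index A_smult_entry del: index_smult_mat)
  moreover have "w ^ d * inverse w ^ (d - Suc l) = w * w ^ l" if "l < d" for l
  proof -
    have "w ^ d = w ^ (Suc l + (d - Suc l))" using that by simp
    also have "\<dots> = w ^ Suc l * w ^ (d - Suc l)" by (rule power_add)
    finally show ?thesis using \<open>w \<noteq> 0\<close> by (simp add: power_inverse)
  qed
  ultimately show ?thesis
    unfolding d_def[symmetric] by (simp add: sum_distrib_left mult.assoc[symmetric])
qed

text \<open>
  Divided by its leading power, the denominator tends to its leading coefficient \<open>I\<close> at infinity.
\<close>

lemma denominator_regular:
  "\<forall>\<^sub>F w in at 0. det (denominator q n A (inverse w)) \<noteq> 0"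
proof -
  define D where "D w = w ^ ((n + 1) div 2) \<cdot>\<^sub>m denominator q n A (inverse w)" for w
  have D: "D w \<in> carrier_mat q q" for w using denominator_carrier by (auto simp: D_def)
  have "((\<lambda>w. det (D w)) \<longlongrightarrow> det (1\<^sub>m q)) (at 0)"
  proof (rule tendsto_det[OF D])
    fix a b assume ab: "a < q" "b < q"
    have "((\<lambda>w. \<Sum>l<Suc (n div 2). w ^ l * A (2 * l) $$ (a, b))
        \<longlongrightarrow> (\<Sum>l<Suc (n div 2). 0 ^ l * A (2 * l) $$ (a, b))) (at 0)"
      by (intro tendsto_intros)
    also have "(\<Sum>l<Suc (n div 2). 0 ^ l * A (2 * l) $$ (a, b)) = 1\<^sub>m q $$ (a, b)"
      by (subst sum.lessThan_Suc_shift) (simp add: A0)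
    finally have lim: "((\<lambda>w. \<Sum>l<Suc (n div 2). w ^ l * A (2 * l) $$ (a, b)) \<longlongrightarrow> 1\<^sub>m q $$ (a, b)) (at 0)" .
    moreover have "\<forall>\<^sub>F w in at 0. (\<Sum>l<Suc (n div 2). w ^ l * A (2 * l) $$ (a, b)) = D w $$ (a, b)"
      unfolding eventually_at_filter
    proof (intro always_eventually allI impI)
      fix w :: complex assume "w \<noteq> 0"
      then show "(\<Sum>l<Suc (n div 2). w ^ l * A (2 * l) $$ (a, b)) = D w $$ (a, b)"
        using denominator_entry[OF ab] denominator_carrier[of "inverse w"] ab by (simp add: D_def del: sum.lessThan_Suc)
    qed
    ultimately show "((\<lambda>w. D w $$ (a, b)) \<longlongrightarrow> 1\<^sub>m q $$ (a, b)) (at 0)"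
      by (rule Lim_transform_eventually)
  qed auto
  then have "\<forall>\<^sub>F w in at 0. det (D w) \<noteq> 0"
    by (rule tendsto_imp_eventually_ne) simp
  then show ?thesis
    by (rule eventually_mono) (auto simp: D_def)
qed

lemma markov_expansion_near_0:
  "\<forall>\<^sub>F w in at 0. \<forall>a<q. \<forall>b<q.
     (\<lambda>j. (- 1) ^ j * s j $$ (a, b) * w ^ (j + 1)) sums (gh_ratio q n A (inverse w) $$ (a, b))"
proof -
  have "\<forall>\<^sub>F z in at_infinity. \<forall>a<q. \<forall>b<q.
      (\<lambda>j. (- 1) ^ j * s j $$ (a, b) * inverse z ^ (j + 1)) sums (gh_ratio q n A z $$ (a, b))"
    using mk by (auto simp: markov_params_def)
  from filterlim_iff[THEN iffD1, OF filterlim_inverse_at_infinity, rule_format, OF this]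
  show ?thesis by simp
qed

lemma gh_ratio_times_denominator:
  assumes "det (denominator q n A z) \<noteq> 0"
  shows "gh_ratio q n A z * denominator q n A z = numerator q n A z"
    and "gh_ratio q n A z \<in> carrier_mat q q"
proof -
  note inv = minv_if_det_nonzero[OF denominator_carrier assms]
  have gh: "gh_ratio q n A z = numerator q n A z * minv (denominator q n A z)"
    by (simp add: gh_ratio_def numerator_def denominator_def)
  then show "gh_ratio q n A z \<in> carrier_mat q q"
    using inv(1) numerator_carrier by auto
  show "gh_ratio q n A z * denominator q n A z = numerator q n A z"
    unfolding gh using inv numerator_carrier[of z] denominator_carrier[of z]
    by (simp add: assoc_mult_mat[of _ q q _ q _ q])
qed

text \<open>
  For large \<open>z = 1/w\<close> the equation \<open>ratio * denominator = numerator\<close> becomes an identity between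
  convergent power series in \<open>w\<close>, whose coefficients must agree.
\<close>

lemma markov_entry_recurrence:
  assumes ab: "a < q" "b < q"
  shows "(\<Sum>c<q. \<Sum>l<Suc (n div 2). (if l \<le> k then (- 1) ^ (k - l) * s (k - l) $$ (a, c) else 0)
      * A (2 * l) $$ (c, b)) = (if k < (n + 1) div 2 then A (2 * k + 1) $$ (a, b) else 0)"
    (is "?C k = ?B k")
proof -
  have "\<forall>\<^sub>F w in at 0. (\<lambda>k. (?C k - ?B k) * w ^ k) sums 0"
    using eventually_conj[OF denominator_regular markov_expansion_near_0]
      eventually_neq_at_within[of 0 0 UNIV]
  proof eventually_elim
    case (elim w)
    then have w: "w \<noteq> 0" and reg: "det (denominator q n A (inverse w)) \<noteq> 0" by auto
    define G where "G c = gh_ratio q n A (inverse w) $$ (a, c)" for c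
    note gh = gh_ratio_times_denominator[OF reg]
    have S: "(\<lambda>j. (- 1) ^ j * s j $$ (a, c) * w ^ j) sums (G c / w)" if "c < q" for c
    proof -
      have "(\<lambda>j. (- 1) ^ j * s j $$ (a, c) * w ^ (j + 1)) sums G c"
        using elim ab that by (simp add: G_def)
      from sums_divide[OF this, of w]
      have "(\<lambda>j. (- 1) ^ j * s j $$ (a, c) * w ^ (j + 1) / w) sums (G c / w)" .
      moreover have "(- 1) ^ j * s j $$ (a, c) * w ^ (j + 1) / w = (- 1) ^ j * s j $$ (a, c) * w ^ j" for j
        using w by simp
      ultimately show ?thesis by (simp only:)
    qed
    have "(\<lambda>k. \<Sum>c<q. \<Sum>l<Suc (n div 2).
        (if l \<le> k then (- 1) ^ (k - l) * s (k - l) $$ (a, c) * w ^ (k - l) else 0) * (w ^ l * A (2 * l) $$ (c, b)))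
        sums (\<Sum>c<q. \<Sum>l<Suc (n div 2). G c / w * (w ^ l * A (2 * l) $$ (c, b)))"
      by (intro sums_sum sums_mult2 sums_shift_up S) auto
    also have "(\<lambda>k. \<Sum>c<q. \<Sum>l<Suc (n div 2).
        (if l \<le> k then (- 1) ^ (k - l) * s (k - l) $$ (a, c) * w ^ (k - l) else 0) * (w ^ l * A (2 * l) $$ (c, b)))
      = (\<lambda>k. ?C k * w ^ k)"
      unfolding sum_distrib_right by (intro ext sum.cong refl) (auto simp flip: power_add)
    also have "(\<Sum>c<q. \<Sum>l<Suc (n div 2). G c / w * (w ^ l * A (2 * l) $$ (c, b)))
        = (\<Sum>c<q. G c / w * (w ^ ((n + 1) div 2) * denominator q n A (inverse w) $$ (c, b)))"
      unfolding sum_distrib_left[symmetric] using denominator_entry w ab(2)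
      by (intro sum.cong refl) simp
    also have "\<dots> = w ^ ((n + 1) div 2) / w * (\<Sum>c<q. G c * denominator q n A (inverse w) $$ (c, b))"
      by (simp add: sum_distrib_left mult_ac)
    also have "(\<Sum>c<q. G c * denominator q n A (inverse w) $$ (c, b))
        = (gh_ratio q n A (inverse w) * denominator q n A (inverse w)) $$ (a, b)"
      using gh(2) denominator_carrier[of "inverse w"] ab
      by (simp add: G_def scalar_prod_def atLeast0LessThan)
    also have "\<dots> = numerator q n A (inverse w) $$ (a, b)" by (simp only: gh(1))
    also have "w ^ ((n + 1) div 2) / w * \<dots> = (\<Sum>l<(n + 1) div 2. w ^ l * A (2 * l + 1) $$ (a, b))"
      using numerator_entry[OF ab w] w by (simp add: field_simps)
    finally have "(\<lambda>k. ?C k * w ^ k) sums (\<Sum>l<(n + 1) div 2. w ^ l * A (2 * l + 1) $$ (a, b))" .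
    moreover have "(\<lambda>k. ?B k * w ^ k) sums (\<Sum>l<(n + 1) div 2. w ^ l * A (2 * l + 1) $$ (a, b))"
    proof -
      have "(\<Sum>l<(n + 1) div 2. w ^ l * A (2 * l + 1) $$ (a, b)) = (\<Sum>l<(n + 1) div 2. ?B l * w ^ l)"
        by (intro sum.cong) auto
      then show ?thesis
        using sums_finite[of "{..<(n + 1) div 2}" "\<lambda>k. ?B k * w ^ k"] by simp
    qed
    ultimately show ?case using sums_diff by (fastforce simp: left_diff_distrib)
  qed
  then obtain r where "r > 0" "\<And>w. w \<noteq> 0 \<Longrightarrow> norm w < r \<Longrightarrow> (\<lambda>k. (?C k - ?B k) * w ^ k) sums 0"
    unfolding eventually_at by (auto simp: dist_norm)
  from power_series_zero[OF this, of k] show ?thesis by simp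
qed

lemma markov_recurrence:
  "mat_sum q (\<lambda>l. signed_moment q s (int k - int l) * A (2 * l)) (Suc (n div 2))
    = (if k < (n + 1) div 2 then A (2 * k + 1) else 0\<^sub>m q q)" (is "?L = ?R")
proof (rule eq_matI)
  have R: "?R \<in> carrier_mat q q" using A[of "2 * k + 1"] by auto
  have Ac: "A (2 * l) \<in> carrier_mat q q" if "l < Suc (n div 2)" for l using that by (intro A) auto
  have sm: "signed_moment q s i \<in> carrier_mat q q" for i by (rule signed_moment_carrier[OF markov_params_carrier])
  have L: "?L \<in> carrier_mat q q" using Ac sm by (intro mat_sum_carrier) auto
  show "dim_row ?L = dim_row ?R" "dim_col ?L = dim_col ?R" using R L by auto
  fix a b assume "a < dim_row ?R" "b < dim_col ?R"
  then have ab: "a < q" "b < q" using R by auto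
  have entry: "signed_moment q s (int k - int l) $$ (a, c)
      = (if l \<le> k then (- 1) ^ (k - l) * s (k - l) $$ (a, c) else 0)" if "c < q" for l c
    using markov_params_carrier[of "k - l"] that ab by (auto simp: signed_moment_def nat_diff_distrib)
  have "?L $$ (a, b) = (\<Sum>l<Suc (n div 2). (signed_moment q s (int k - int l) * A (2 * l)) $$ (a, b))"
    using Ac sm ab by (intro mat_sum_index) auto
  also have "\<dots> = (\<Sum>l<Suc (n div 2). \<Sum>c<q. (if l \<le> k then (- 1) ^ (k - l) * s (k - l) $$ (a, c) else 0)
      * A (2 * l) $$ (c, b))"
  proof (rule sum.cong)
    fix l assume "l \<in> {..<Suc (n div 2)}"
    then show "(signed_moment q s (int k - int l) * A (2 * l)) $$ (a, b)
        = (\<Sum>c<q. (if l \<le> k then (- 1) ^ (k - l) * s (k - l) $$ (a, c) else 0) * A (2 * l) $$ (c, b))"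
      using Ac[of l] sm[of "int k - int l"] ab entry by (simp add: scalar_prod_def atLeast0LessThan)
  qed simp
  also have "\<dots> = ?R $$ (a, b)"
    using markov_entry_recurrence[OF ab, of k] ab by (subst sum.swap) simp
  finally show "?L $$ (a, b) = ?R $$ (a, b)" .
qed

text \<open>
  The polynomial with the coefficient \<open>A (2 * (m - i))\<close> at \<open>z\<^sup>i\<close> is \<open>h\<close> for \<open>n = 2m\<close> and \<open>g\<close> for
  \<open>n = 2m + 1\<close>. The polynomial part of its product with the series has the coefficients of odd index,
  and the remainder vanishes.
\<close>

lemma laurent_coeff_of_polynomial:
  assumes "int (n div 2) + k \<ge> 0"
  shows "laurent_coeff q s (n div 2) (\<lambda>i. A (2 * (n div 2 - i))) k
    = (if nat (int (n div 2) + k) < (n + 1) div 2 then A (2 * nat (int (n div 2) + k) + 1) else 0\<^sub>m q q)"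
proof -
  define m where "m = n div 2"
  have Ac: "A (2 * (m - i)) \<in> carrier_mat q q" for i by (intro A) (auto simp: m_def)
  have sm: "signed_moment q s i \<in> carrier_mat q q" for i by (rule signed_moment_carrier[OF markov_params_carrier])
  define f where "f l = signed_moment q s (int (nat (int m + k)) - int l) * A (2 * l)" for l
  have f: "f l \<in> carrier_mat q q" if "l < Suc m" for l
    using Ac[of "m - l"] sm that by (auto simp: f_def)
  have "laurent_coeff q s m (\<lambda>i. A (2 * (m - i))) k = mat_sum q (\<lambda>i. f (Suc m - Suc i)) (Suc m)"
    unfolding laurent_coeff_def
  proof (rule mat_sum_cong)
    fix i assume "i < Suc m"
    then have "int (nat (int m + k)) - int (m - i) = int i + k" using assms by (simp add: m_def)
    then show "signed_moment q s (int i + k) * A (2 * (m - i)) = f (Suc m - Suc i)"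
      by (simp add: f_def)
  qed
  also have "\<dots> = mat_sum q f (Suc m)"
  proof (rule eq_matI)
    have c: "mat_sum q f (Suc m) \<in> carrier_mat q q" using f by (rule mat_sum_carrier)
    have c': "mat_sum q (\<lambda>i. f (Suc m - Suc i)) (Suc m) \<in> carrier_mat q q"
      using f by (intro mat_sum_carrier) auto
    show "dim_row (mat_sum q (\<lambda>i. f (Suc m - Suc i)) (Suc m)) = dim_row (mat_sum q f (Suc m))"
      "dim_col (mat_sum q (\<lambda>i. f (Suc m - Suc i)) (Suc m)) = dim_col (mat_sum q f (Suc m))"
      using c c' by (auto simp del: mat_sum.simps)
    fix a b assume "a < dim_row (mat_sum q f (Suc m))" "b < dim_col (mat_sum q f (Suc m))"
    then have ab: "a < q" "b < q" using c by (auto simp del: mat_sum.simps)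
    have "mat_sum q (\<lambda>i. f (Suc m - Suc i)) (Suc m) $$ (a, b) = (\<Sum>i<Suc m. f (Suc m - Suc i) $$ (a, b))"
      using f ab by (intro mat_sum_index) auto
    also have "\<dots> = (\<Sum>i<Suc m. f i $$ (a, b))"
      by (rule sum.nat_diff_reindex)
    also have "\<dots> = mat_sum q f (Suc m) $$ (a, b)"
      using f ab by (intro mat_sum_index[symmetric]) auto
    finally show "mat_sum q (\<lambda>i. f (Suc m - Suc i)) (Suc m) $$ (a, b) = mat_sum q f (Suc m) $$ (a, b)" .
  qed
  also have "\<dots> = (if nat (int m + k) < (n + 1) div 2 then A (2 * nat (int m + k) + 1) else 0\<^sub>m q q)"
    unfolding f_def m_def by (rule markov_recurrence)
  finally show ?thesis unfolding m_def .
qed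

text \<open>
  Both \<open>h\<close> and \<open>\<Phi>\<^sub>m E\<^sub>m\<close> are monic of degree \<open>m\<close> and orthogonal, hence equal; then so are the polynomial
  parts \<open>g\<close> and \<open>\<Psi>\<^sub>m E\<^sub>m\<close> of their products with \<open>S\<close>.
\<close>

lemma even_degree_coefficients:
  assumes n: "n = 2 * m" and "m \<ge> 1" and pos: "stieltjes_positive q s (n - 1)"
  shows "j \<le> m \<Longrightarrow> A (n - 2 * j) = Phi q s j m * even_prod q s m"
    and "j < m \<Longrightarrow> A (n - (2 * j + 1)) = Psi q s j m * even_prod q s m"
proof -
  define E where "E = even_prod q s m"
  define p where "p i = A (2 * (m - i))" for i
  define p' where "p' i = Phi q s i m * E" for i
  have inv: "Stieltjes_even q s m" using Stieltjes_even_odd[OF markov_params_carrier pos, of m] n by simp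
  have carr: "P1_0 q s l \<in> carrier_mat q q" "Q2_0 q s l \<in> carrier_mat q q" if "l < m" for l
    using inv that by (auto simp: Stieltjes_even_def)
  have \<Phi>: "Phi q s i m \<in> carrier_mat q q" for i by (rule Phi_Theta_carrier(1)[OF markov_params_carrier carr])
  have E: "E \<in> carrier_mat q q" using inv by (auto simp: Stieltjes_even_def E_def)
  have lc': "laurent_coeff q s m p' k = laurent_coeff q s m (\<lambda>i. Phi q s i m) k * E" for k
    unfolding p'_def by (rule laurent_coeff_mult_right[OF markov_params_carrier \<Phi> E])
  have lc: "laurent_coeff q s m p k
      = (if nat (int m + k) < m then A (2 * nat (int m + k) + 1) else 0\<^sub>m q q)" if "int m + k \<ge> 0" for k
    using laurent_coeff_of_polynomial[of k] that n by (simp add: p_def[abs_def])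
  have eq: "p i = p' i" if "i \<le> m" for i
  proof (rule signed_orthogonal_unique[OF markov_params_carrier, where e = 0, OF _ _ _ _ _ _ _ that])
    show "p i \<in> carrier_mat q q" for i by (auto simp: p_def n intro!: A)
    show "p' i \<in> carrier_mat q q" for i using \<Phi> E by (auto simp: p'_def)
    show "p m = 1\<^sub>m q" by (simp add: p_def A0)
    show "p' m = 1\<^sub>m q" using inv by (simp add: p'_def E_def Stieltjes_even_def)
    show "laurent_coeff q s m p (int (k + 0)) = 0\<^sub>m q q" for k using lc[of "int k"] by auto
    show "laurent_coeff q s m p' (int (k + 0)) = 0\<^sub>m q q" if "k < m" for k
      using lc' inv E that by (simp add: Stieltjes_even_def)
    show "herm_pos_def (m * q) (H1 q (\<lambda>i. s (i + 0)) (m - 1))"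
      using H1_pos[OF markov_params_carrier pos, of "m - 1"] n \<open>m \<ge> 1\<close> by simp
  qed
  show "A (n - 2 * j) = Phi q s j m * even_prod q s m" if "j \<le> m"
    using eq[OF that] n by (simp add: p_def p'_def E_def diff_mult_distrib2)
  show "A (n - (2 * j + 1)) = Psi q s j m * even_prod q s m" if "j < m"
  proof -
    have "nat (int m + - int (Suc j)) = m - Suc j" using that by simp
    moreover have "2 * (m - Suc j) + 1 = n - (2 * j + 1)" using that n by simp
    ultimately have "A (n - (2 * j + 1)) = laurent_coeff q s m p (- int (Suc j))"
      using lc[of "- int (Suc j)"] that by simp
    also have "\<dots> = laurent_coeff q s m p' (- int (Suc j))"
      by (rule laurent_coeff_cong[OF markov_params_carrier]) (rule eq)
    also have "\<dots> = Psi q s j m * E"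
      unfolding lc' using inv by (simp add: Stieltjes_even_def)
    finally show ?thesis by (simp add: E_def)
  qed
qed

text \<open>
  The same comparison of \<open>g\<close> with \<open>\<Theta>\<^sub>m D\<^sub>m\<close>, for \<open>z S\<close> in place of \<open>S\<close>.
\<close>

lemma odd_degree_coefficients:
  assumes n: "n = 2 * m + 1" and pos: "stieltjes_positive q s (n - 1)" and "j \<le> m"
  shows "A (n - 2 * j) = Xi q s j m * odd_prod q s m"
    and "A (n - (2 * j + 1)) = Theta q s j m * odd_prod q s m"
proof -
  define D where "D = odd_prod q s m"
  define p where "p i = A (2 * (m - i))" for i
  define p' where "p' i = Theta q s i m * D" for i
  have inv: "Stieltjes_odd q s m" and inv': "Stieltjes_even q s m"
    using Stieltjes_even_odd[OF markov_params_carrier pos, of m] n by auto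
  have carr: "P1_0 q s l \<in> carrier_mat q q" "Q2_0 q s l \<in> carrier_mat q q" if "l < m" for l
    using inv' that by (auto simp: Stieltjes_even_def)
  have M: "P1_0 q s m \<in> carrier_mat q q" using inv by (auto simp: Stieltjes_odd_def)
  have \<Theta>: "Theta q s i m \<in> carrier_mat q q" for i
    by (rule Phi_Theta_carrier(2)[OF markov_params_carrier carr M])
  have D: "D \<in> carrier_mat q q" using inv by (auto simp: Stieltjes_odd_def D_def)
  have lc': "laurent_coeff q s m p' k = laurent_coeff q s m (\<lambda>i. Theta q s i m) k * D" for k
    unfolding p'_def by (rule laurent_coeff_mult_right[OF markov_params_carrier \<Theta> D])
  have lc: "laurent_coeff q s m p k
      = (if nat (int m + k) \<le> m then A (2 * nat (int m + k) + 1) else 0\<^sub>m q q)" if "int m + k \<ge> 0" for k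
    using laurent_coeff_of_polynomial[of k] that n by (simp add: p_def[abs_def] less_Suc_eq_le)
  have eq: "p i = p' i" if "i \<le> m" for i
  proof (rule signed_orthogonal_unique[OF markov_params_carrier, where e = 1, OF _ _ _ _ _ _ _ that])
    show "p i \<in> carrier_mat q q" for i by (auto simp: p_def n intro!: A)
    show "p' i \<in> carrier_mat q q" for i using \<Theta> D by (auto simp: p'_def)
    show "p m = 1\<^sub>m q" by (simp add: p_def A0)
    show "p' m = 1\<^sub>m q" using inv by (simp add: p'_def D_def Stieltjes_odd_def)
    show "laurent_coeff q s m p (int (k + 1)) = 0\<^sub>m q q" for k using lc[of "int (k + 1)"] by auto
    show "laurent_coeff q s m p' (int (k + 1)) = 0\<^sub>m q q" if "k < m" for k
      using lc' inv D that by (simp add: Stieltjes_odd_def)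
    show "herm_pos_def (m * q) (H1 q (\<lambda>i. s (i + 1)) (m - 1))" if "m \<ge> 1"
      using H2_pos[OF markov_params_carrier pos, of "m - 1"] n that by (simp add: H2_eq_H1_shift)
  qed
  show "A (n - (2 * j + 1)) = Theta q s j m * odd_prod q s m"
    using eq[OF \<open>j \<le> m\<close>] n by (simp add: p_def p'_def D_def diff_mult_distrib2)
  have "nat (int m + - int j) = m - j" using \<open>j \<le> m\<close> by simp
  moreover have "2 * (m - j) + 1 = n - 2 * j" using \<open>j \<le> m\<close> n by simp
  ultimately have "A (n - 2 * j) = laurent_coeff q s m p (- int j)"
    using lc[of "- int j"] \<open>j \<le> m\<close> by simp
  also have "\<dots> = laurent_coeff q s m p' (- int j)"
    by (rule laurent_coeff_cong[OF markov_params_carrier]) (rule eq)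
  also have "\<dots> = Xi q s j m * D"
    unfolding lc' using inv by (simp add: Stieltjes_odd_def)
  finally show "A (n - 2 * j) = Xi q s j m * odd_prod q s m" by (simp add: D_def)
qed

end

theorem theorem4p6:
  fixes q n :: nat and A s :: "nat \<Rightarrow> complex mat"
  assumes "q \<ge> 1" and "n \<ge> 1"
    and "A 0 = 1\<^sub>m q" and "\<And>j. j \<le> n \<Longrightarrow> A j \<in> carrier_mat q q"
    and "HTM_poly q n A"
    and "markov_params q n A s"
    and "stieltjes_positive q s (n - 1)"
  shows "(\<forall>m\<ge>1. n = 2 * m \<longrightarrow>
            (\<forall>j\<le>m. A (n - 2 * j) = Phi q s j m * even_prod q s m) \<and>
            (\<forall>j\<le>m - 1. A (n - (2 * j + 1)) = Psi q s j m * even_prod q s m)) \<and>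
         (\<forall>m. n = 2 * m + 1 \<longrightarrow>
            (\<forall>j\<le>m. A (n - 2 * j) = Xi q s j m * odd_prod q s m) \<and>
            (\<forall>j\<le>m. A (n - (2 * j + 1)) = Theta q s j m * odd_prod q s m))"
proof (intro conjI allI impI)
  fix m j assume m: "m \<ge> 1" "n = 2 * m"
  show "A (n - 2 * j) = Phi q s j m * even_prod q s m" if "j \<le> m"
    by (rule even_degree_coefficients(1)[OF assms(3,4,6) m(2,1) assms(7) that])
  show "A (n - (2 * j + 1)) = Psi q s j m * even_prod q s m" if "j \<le> m - 1"
  proof -
    have "j < m" using that m(1) by simp
    show ?thesis by (rule even_degree_coefficients(2)[OF assms(3,4,6) m(2,1) assms(7) \<open>j < m\<close>])
  qed
next
  fix m j assume m: "n = 2 * m + 1" "j \<le> m"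
  show "A (n - 2 * j) = Xi q s j m * odd_prod q s m"
    by (rule odd_degree_coefficients(1)[OF assms(3,4,6) m(1) assms(7) m(2)])
  show "A (n - (2 * j + 1)) = Theta q s j m * odd_prod q s m"
    by (rule odd_degree_coefficients(2)[OF assms(3,4,6) m(1) assms(7) m(2)])
qed

end
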